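(* Let $M_n=F_n/F_n''$ be the free metabelian group of rank $n\ge 2$ with basis the images $x_1,\dots,x_n$ of the free generators. (i) The group $\mathrm{Aut}\,M_2$ acts transitively on the set of $\Delta$-primitive elements of $M_2$: every $\Delta$-primitive element of $M_2$ is an automorphic image of $[x_1,x_2]$, and in fact has the form $[x_1,x_2]^g$ or $[x_2,x_1]^g$ for some $g\in M_2$. (ii) If $n$ is odd, $M_n$ has no $\Delta$-primitive elements.
   Context: Let $A_n=M_n/M_n'\cong F_n/F_n'$ (free abelian of rank $n$), $\mathbb{Z}A_n$ its integral group ring and $\Delta_A$ its augmentation ideal. For $g\in F_n$, the left Fox derivatives $d_i(g)\in\mathbb{Z}F_n$ are the unique elements with $g-1=\sum_{i=1}^n d_i(g)(x_i-1)$. For $h\in M_n$ the abelianized Fox derivatives $d_i(h)\in\mathbb{Z}A_n$ are the images in $\mathbb{Z}A_n$ of $d_i(\tilde h)$ for any preimage $\tilde h\in F_n$ of $h$ (this does not depend on the choice of preimage). An element $h\in M_n$ is $\Delta$-primitive if $d_1(h),\dots,d_n(h)$ generate $\Delta_A$ as an ideal of $\mathbb{Z}A_n$. $[a,b]=a^{-1}b^{-1}ab$, $a^g=g^{-1}ag$. *)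

theory Defs
  imports "HOL-Algebra.Algebra" "HOL-Library.Poly_Mapping"
begin

text \<open>A letter (i, b) stands for the generator x_i (b = False) or its inverse (b = True).
  Generators are indexed 0..n-1 (the paper's x_1..x_n).\<close>

type_synonym fword = "(nat \<times> bool) list"

inductive fred :: "fword \<Rightarrow> fword \<Rightarrow> bool" where
  "fred (u @ (i, b) # (i, \<not> b) # v) (u @ v)"

definition fequiv :: "fword \<Rightarrow> fword \<Rightarrow> bool" where
  "fequiv = (sup fred fred\<inverse>\<inverse>)\<^sup>*\<^sup>*"

definition fclass :: "fword \<Rightarrow> fword set" where
  "fclass w = {v. fequiv w v}"

definition fwords :: "nat \<Rightarrow> fword set" where
  "fwords n = {w. \<forall>l\<in>set w. fst l < n}"

definition FG :: "nat \<Rightarrow> fword set monoid" where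
  "FG n = \<lparr>carrier = fclass ` fwords n,
           monoid.mult = (\<lambda>A B. fclass ((SOME u. u \<in> A) @ (SOME v. v \<in> B))),
           monoid.one = fclass []\<rparr>"

definition FG2 :: "nat \<Rightarrow> fword set set" where
  "FG2 n = derived (FG n) (derived (FG n) (carrier (FG n)))"

definition MG :: "nat \<Rightarrow> fword set set monoid" where
  "MG n = FG n Mod FG2 n"

definition mgen :: "nat \<Rightarrow> nat \<Rightarrow> fword set set" where
  "mgen n i = r_coset (FG n) (FG2 n) (fclass [(i, False)])"

definition gcomm :: "('a, 'b) monoid_scheme \<Rightarrow> 'a \<Rightarrow> 'a \<Rightarrow> 'a" where
  "gcomm G a b = inv\<^bsub>G\<^esub> a \<otimes>\<^bsub>G\<^esub> inv\<^bsub>G\<^esub> b \<otimes>\<^bsub>G\<^esub> a \<otimes>\<^bsub>G\<^esub> b"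

definition gconj :: "('a, 'b) monoid_scheme \<Rightarrow> 'a \<Rightarrow> 'a \<Rightarrow> 'a" where
  "gconj G a g = inv\<^bsub>G\<^esub> g \<otimes>\<^bsub>G\<^esub> a \<otimes>\<^bsub>G\<^esub> g"

text \<open>Elements of Z[A] are finitely supported integer functions on exponent vectors
  (Laurent polynomials); Z A_n consists of those involving only the variables 0..n-1.\<close>
type_synonym za = "(nat \<Rightarrow>\<^sub>0 int) \<Rightarrow>\<^sub>0 int"

definition ZA :: "nat \<Rightarrow> za set" where
  "ZA n = {p. \<forall>a\<in>Poly_Mapping.keys p. Poly_Mapping.keys a \<subseteq> {..<n}}"

definition augm :: "za \<Rightarrow> int" where
  "augm p = (\<Sum>a\<in>Poly_Mapping.keys p. Poly_Mapping.lookup p a)"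

definition DeltaA :: "nat \<Rightarrow> za set" where
  "DeltaA n = {p \<in> ZA n. augm p = 0}"

definition letter_mono :: "nat \<times> bool \<Rightarrow> za" where
  "letter_mono l = Poly_Mapping.single (Poly_Mapping.single (fst l) (if snd l then -1 else 1)) 1"

text \<open>Abelianized Fox derivative of a word, via the Fox rules
  d_i(uv) = d_i(u) + u d_i(v), d_i(x_j) = delta_ij, d_i(x_j^-1) = - delta_ij x_j^-1.\<close>
fun fox :: "nat \<Rightarrow> fword \<Rightarrow> za" where
  "fox i [] = 0"
| "fox i (l # w) =
     (if fst l = i then (if snd l then - letter_mono l else 1) else 0) + letter_mono l * fox i w"

text \<open>Abelianized Fox derivative of an element h of M_n (computed from any preimage word).\<close>
definition mfox :: "nat \<Rightarrow> nat \<Rightarrow> fword set set \<Rightarrow> za" where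
  "mfox n i h = fox i (SOME w. w \<in> \<Union>h \<inter> fwords n)"

definition delta_primitive :: "nat \<Rightarrow> fword set set \<Rightarrow> bool" where
  "delta_primitive n h \<longleftrightarrow> h \<in> carrier (MG n) \<and>
     {\<Sum>i<n. r i * mfox n i h | r. \<forall>i<n. r i \<in> ZA n} = DeltaA n"

end

theory Submission
  imports Defs "Jordan_Normal_Form.Determinant"
begin

text \<open>
  If \<open>h\<close> is \<open>\<Delta>\<close>-primitive, its Fox derivatives have augmentation 0, so \<open>h\<close> lies in the derived
  subgroup \<open>D\<close>, which is an abelian group acted on by the group ring. For rank 2, \<open>D\<close> is a cyclic
  module generated by \<open>c = [x\<^sub>1, x\<^sub>2]\<close>, so \<open>h = r c\<close> for some \<open>r\<close>, and the Fox derivatives of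
  \<open>h\<close> are \<open>r\<close> times those of \<open>c\<close>. As the latter are \<open>x\<^sub>2 - 1\<close> and \<open>x\<^sub>1 - 1\<close> up to units, \<open>r\<close>
  divides both \<open>x\<^sub>1 - 1\<close> and \<open>x\<^sub>2 - 1\<close>; comparing the ranges of the exponents shows that \<open>r\<close> is
  plus or minus a monomial, that is, \<open>h\<close> is a conjugate of \<open>c\<close> or its inverse. Invariance under
  automorphisms holds because \<open>h\<close> is \<open>\<Delta>\<close>-primitive iff its normal closure is \<open>D\<close>.

  For any rank \<open>n\<close>, taking second derivatives of \<open>\<Sum>i. d\<^sub>i(h) (x\<^sub>i - 1) = 0\<close> at 1 shows that the
  linear parts of the \<open>d\<^sub>i(h)\<close> form a skew-symmetric matrix \<open>B\<close>. If the \<open>d\<^sub>i(h)\<close> generate \<open>\<Delta>\<close>,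
  then \<open>B\<close> is invertible over the integers, which is impossible for odd \<open>n\<close>.
\<close>

section \<open>Laurent polynomials\<close>

text \<open>Support contained in a set of exponent vectors is the form in which the free Abelian
  group on these vectors, its induction rule and its universal property are stated.\<close>

lemma ZA_iff: "p \<in> ZA n \<longleftrightarrow> Poly_Mapping.keys p \<subseteq> {a. Poly_Mapping.keys a \<subseteq> {..<n}}"
  by (auto simp: ZA_def)

lemma ZA_0 [simp]: "0 \<in> ZA n"
  and ZA_1 [simp]: "1 \<in> ZA n"
  and ZA_add: "p \<in> ZA n \<Longrightarrow> q \<in> ZA n \<Longrightarrow> p + q \<in> ZA n"
  and ZA_uminus: "p \<in> ZA n \<Longrightarrow> - p \<in> ZA n"
  and ZA_minus: "p \<in> ZA n \<Longrightarrow> q \<in> ZA n \<Longrightarrow> p - q \<in> ZA n"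
  using keys_add[of p q] keys_diff[of p q] by (auto simp: ZA_def)

lemma ZA_frag_of [simp]: "frag_of a \<in> ZA n \<longleftrightarrow> Poly_Mapping.keys a \<subseteq> {..<n}"
  by (simp add: ZA_def)

lemma ZA_mult:
  assumes "p \<in> ZA n" "q \<in> ZA n"
  shows "p * q \<in> ZA n"
  unfolding ZA_def
proof safe
  fix a i assume "a \<in> Poly_Mapping.keys (p * q)" "i \<in> Poly_Mapping.keys a"
  then obtain b c where "b \<in> Poly_Mapping.keys p" "c \<in> Poly_Mapping.keys q" "a = b + c"
    using keys_mult[of p q] by auto
  with \<open>i \<in> Poly_Mapping.keys a\<close> assms show "i < n"
    using keys_add[of b c] by (fastforce simp: ZA_def)
qed

lemma ZA_sum: "(\<And>i. i \<in> I \<Longrightarrow> f i \<in> ZA n) \<Longrightarrow> sum f I \<in> ZA n"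
  by (induction I rule: infinite_finite_induct) (auto intro: ZA_add)

lemma frag_of_add: "frag_of (a + b) = (frag_of a * frag_of b :: za)"
  by (simp add: mult_single)

section \<open>Additive functionals on the group ring\<close>

text \<open>The additive extension of \<open>f\<close> from monomials to all of the group ring.
  Augmentation, coefficient extraction and derivatives at 1 are the instances used below.\<close>

definition lin :: "('a \<Rightarrow> int) \<Rightarrow> ('a \<Rightarrow>\<^sub>0 int) \<Rightarrow> int" where
  "lin f p = (\<Sum>a\<in>Poly_Mapping.keys p. Poly_Mapping.lookup p a * f a)"

lemma lin_superset:
  assumes "finite S" "Poly_Mapping.keys p \<subseteq> S"
  shows "lin f p = (\<Sum>a\<in>S. Poly_Mapping.lookup p a * f a)"
  unfolding lin_def using assms
  by (intro sum.mono_neutral_left) (auto simp: in_keys_iff)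

lemma lin_0 [simp]: "lin f 0 = 0"
  and lin_frag_of [simp]: "lin f (frag_of a) = f a"
  by (simp_all add: lin_def)

lemma lin_1 [simp]: "lin f (1 :: za) = f 0"
  by (simp add: lin_def)

lemma lin_add: "lin f (p + q) = lin f p + lin f q"
proof -
  let ?S = "Poly_Mapping.keys p \<union> Poly_Mapping.keys q"
  have "lin f (p + q) = (\<Sum>a\<in>?S. Poly_Mapping.lookup (p + q) a * f a)"
    using keys_add[of p q] by (intro lin_superset) auto
  also have "\<dots> = lin f p + lin f q"
    by (simp add: lin_superset[of ?S p] lin_superset[of ?S q] lookup_add ring_distribs sum.distrib)
  finally show ?thesis .
qed

lemma lin_uminus: "lin f (- p) = - lin f p"
  using lin_add[of f p "- p"] by simp

lemma lin_minus: "lin f (p - q) = lin f p - lin f q"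
  using lin_add[of f p "- q"] by (simp add: lin_uminus)

lemma lin_sum: "lin f (sum g I) = (\<Sum>i\<in>I. lin f (g i))"
  by (induction I rule: infinite_finite_induct) (auto simp: lin_add)

lemma lin_fun_add: "lin (\<lambda>a. f a + g a) p = lin f p + lin g p"
  by (simp add: lin_def ring_distribs sum.distrib)

lemma lin_fun_mult: "lin (\<lambda>a. c * f a) p = c * lin f p"
  "lin (\<lambda>a. f a * c) p = lin f p * c"
  by (simp_all add: lin_def sum_distrib_left sum_distrib_right mult_ac)

lemma lin_delta: "lin (\<lambda>y. if y = b then c else 0) p = Poly_Mapping.lookup p b * c"
proof -
  have "lin (\<lambda>y. if y = b then c else 0) p =
      (\<Sum>y\<in>insert b (Poly_Mapping.keys p). Poly_Mapping.lookup p y * (if y = b then c else 0))"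
    by (rule lin_superset) auto
  also have "\<dots> = (\<Sum>y\<in>insert b (Poly_Mapping.keys p). if y = b then Poly_Mapping.lookup p b * c else 0)"
    by (rule sum.cong) auto
  also have "\<dots> = Poly_Mapping.lookup p b * c"
    by (subst sum.delta) auto
  finally show ?thesis .
qed

text \<open>Both sides are additive in \<open>p\<close> and in \<open>q\<close>, so the claim
  reduces to two monomials, where it is \<open>frag_of_add\<close>.\<close>

lemma lin_mult: "lin f (p * q) = lin (\<lambda>a. lin (\<lambda>b. f (a + b)) q) (p :: za)"
proof -
  have *: "lin f (frag_of a * q) = lin (\<lambda>b. f (a + b)) q" for a :: "nat \<Rightarrow>\<^sub>0 int"
    by (rule frag_induction[of q UNIV]) (simp_all add: right_diff_distrib lin_minus flip: frag_of_add)
  show ?thesis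
    by (rule frag_induction[of p UNIV]) (simp_all add: * left_diff_distrib lin_minus)
qed

text \<open>The operators \<open>x\<^sub>k \<partial>/\<partial>x\<^sub>k\<close> and their twofold products, followed by evaluation at 1.\<close>

abbreviation D1 :: "nat \<Rightarrow> za \<Rightarrow> int" where
  "D1 k \<equiv> lin (\<lambda>a. Poly_Mapping.lookup a k)"

abbreviation D2 :: "nat \<Rightarrow> nat \<Rightarrow> za \<Rightarrow> int" where
  "D2 j k \<equiv> lin (\<lambda>a. Poly_Mapping.lookup a j * Poly_Mapping.lookup a k)"

lemma augm_eq_lin: "augm = lin (\<lambda>_. 1)"
  by (simp add: fun_eq_iff augm_def lin_def)

lemma augm_simps [simp]: "augm 0 = 0" "augm (frag_of a) = 1" "augm 1 = 1"
  "augm (p + q) = augm p + augm q" "augm (- p) = - augm p" "augm (p - q) = augm p - augm q"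
  "augm (sum f I) = (\<Sum>i\<in>I. augm (f i))"
  by (simp_all add: augm_eq_lin lin_add lin_uminus lin_minus lin_sum)

lemma lin_const [simp]: "lin (\<lambda>_. c) p = c * augm p"
  using lin_fun_mult(1)[of c "\<lambda>_. 1" p] by (simp add: augm_eq_lin)

lemma augm_mult [simp]: "augm (p * q) = augm p * augm q"
  using lin_mult[of "\<lambda>_. 1" p q] by (simp add: mult.commute)

text \<open>Exponents add when monomials are multiplied, so \<open>lin_mult\<close> becomes the
  Leibniz rule evaluated at 1. \<open>D2_mult\<close> is its second-order analogue.\<close>

lemma D1_mult: "D1 k (p * q) = D1 k p * augm q + augm p * D1 k q"
  by (simp add: lin_mult lookup_add lin_fun_add lin_fun_mult mult.commute)

lemma D2_mult: "D2 j k (p * q) =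
    D2 j k p * augm q + D1 j p * D1 k q + D1 k p * D1 j q + augm p * D2 j k q"
  by (simp add: lin_mult lookup_add lin_fun_add lin_fun_mult ring_distribs mult_ac)

definition xvar :: "nat \<Rightarrow> za" where
  "xvar i = frag_of (Poly_Mapping.single i 1)"

lemma xvar_ZA: "i < n \<Longrightarrow> xvar i \<in> ZA n"
  by (simp add: xvar_def)

lemma augm_xvar [simp]: "augm (xvar i) = 1"
  and D1_xvar [simp]: "D1 k (xvar i) = (if i = k then 1 else 0)"
  and D1_one [simp]: "D1 k 1 = 0"
  and D2_xvar [simp]: "D2 j k (xvar i) = (if i = j \<and> i = k then 1 else 0)"
  and D2_one [simp]: "D2 j k 1 = 0"
  by (simp_all add: xvar_def lookup_single when_def)

section \<open>Divisors of \<open>xvar i - 1\<close>\<close>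

text \<open>The largest exponent of the \<open>k\<close>-th variable in a product is the sum of the
  largest ones in the factors, and likewise for the smallest. Both are 0 for
  \<open>xvar i - 1\<close>, so neither factor can have a positive spread of exponents.\<close>

lemma factor_of_xvar_minus_1_keys:
  fixes r s :: za
  assumes rs: "r * s = xvar i - 1" and "k \<noteq> i"
    and ab: "a \<in> Poly_Mapping.keys r" "b \<in> Poly_Mapping.keys r"
  shows "Poly_Mapping.lookup a k = Poly_Mapping.lookup b k"
proof -
  have top: "\<exists>a\<in>Poly_Mapping.keys r. \<exists>b\<in>Poly_Mapping.keys s.
      (\<forall>a'\<in>Poly_Mapping.keys r. c * Poly_Mapping.lookup a' k \<le> c * Poly_Mapping.lookup a k) \<and>
      (\<forall>b'\<in>Poly_Mapping.keys s. c * Poly_Mapping.lookup b' k \<le> c * Poly_Mapping.lookup b k) \<and>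
      Poly_Mapping.lookup a k + Poly_Mapping.lookup b k = 0" for c :: int
  proof -
    \<comment> \<open>Leading monomials for the ordering by \<open>c\<close> times the \<open>k\<close>-th exponent, with ties broken
      lexicographically, are multiplicative.\<close>
    define better where "better p a \<longleftrightarrow> a \<in> Poly_Mapping.keys p \<and>
      (\<forall>a'\<in>Poly_Mapping.keys p. c * Poly_Mapping.lookup a' k < c * Poly_Mapping.lookup a k \<or>
         c * Poly_Mapping.lookup a' k = c * Poly_Mapping.lookup a k \<and> a' \<le> a)" for p :: za and a
    have ex: "\<exists>a. better p a" if "p \<noteq> 0" for p
    proof -
      let ?K = "Poly_Mapping.keys p"
      let ?m = "Max ((\<lambda>a. c * Poly_Mapping.lookup a k) ` ?K)"
      let ?L = "{a\<in>?K. c * Poly_Mapping.lookup a k = ?m}"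
      have "?m \<in> (\<lambda>a. c * Poly_Mapping.lookup a k) ` ?K"
        using that by (intro Max_in) auto
      then have "?L \<noteq> {}" by force
      then have L: "Max ?L \<in> ?L" by (intro Max_in) auto
      have "better p (Max ?L)"
        unfolding better_def
      proof (intro conjI ballI)
        show "Max ?L \<in> ?K" using L by blast
        fix a' assume a': "a' \<in> ?K"
        then have "c * Poly_Mapping.lookup a' k \<le> ?m" by (intro Max_ge) auto
        moreover have "c * Poly_Mapping.lookup a' k = ?m \<Longrightarrow> a' \<le> Max ?L"
          using a' by (intro Max_ge) auto
        moreover have "c * Poly_Mapping.lookup (Max ?L) k = ?m" using L by blast
        ultimately show "c * Poly_Mapping.lookup a' k < c * Poly_Mapping.lookup (Max ?L) k \<or>
            c * Poly_Mapping.lookup a' k = c * Poly_Mapping.lookup (Max ?L) k \<and> a' \<le> Max ?L"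
          by linarith
      qed
      then show ?thesis ..
    qed
    have "r * s \<noteq> 0"
      using arg_cong[OF rs, of "D1 i"] by (auto simp: lin_minus)
    then have "r \<noteq> 0" "s \<noteq> 0" by auto
    with ex obtain a b where a: "better r a" and b: "better s b" by blast
    \<comment> \<open>This functional reads off the coefficient of \<open>r * s\<close> at
      \<open>a + b\<close>. By the choice of \<open>a\<close> and \<open>b\<close>, no other pair of
      monomials contributes to it.\<close>
    have "lin (\<lambda>y. if y = a + b then 1 else 0) (r * s) =
        lin (\<lambda>x. if x = a then Poly_Mapping.lookup s b else 0) r"
      unfolding lin_mult lin_def[of _ r]
    proof (rule sum.cong[OF refl])
      fix x assume x: "x \<in> Poly_Mapping.keys r"
      have "x = a \<and> y = b" if "y \<in> Poly_Mapping.keys s" "x + y = a + b" for y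
      proof -
        have "c * Poly_Mapping.lookup x k + c * Poly_Mapping.lookup y k =
            c * Poly_Mapping.lookup a k + c * Poly_Mapping.lookup b k"
          using arg_cong[OF that(2), of "\<lambda>z. c * Poly_Mapping.lookup z k"]
          by (simp add: lookup_add ring_distribs)
        moreover have "c * Poly_Mapping.lookup x k < c * Poly_Mapping.lookup a k \<or>
            c * Poly_Mapping.lookup x k = c * Poly_Mapping.lookup a k \<and> x \<le> a"
          using a x unfolding better_def by blast
        moreover have "c * Poly_Mapping.lookup y k < c * Poly_Mapping.lookup b k \<or>
            c * Poly_Mapping.lookup y k = c * Poly_Mapping.lookup b k \<and> y \<le> b"
          using b that(1) unfolding better_def by blast
        ultimately have le: "x \<le> a" "y \<le> b" by auto
        have "\<not> x < a"
        proof
          assume "x < a"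
          then have "x + y < a + b" using le(2) by (rule add_less_le_mono)
          with that(2) show False by simp
        qed
        with antisym_conv2[OF le(1)] have "x = a" by blast
        with that(2) show ?thesis by simp
      qed
      then have "lin (\<lambda>y. if x + y = a + b then 1 else 0) s =
          lin (\<lambda>y. if y = b then if x = a then 1 else 0 else 0) s"
        unfolding lin_def by (intro sum.cong) auto
      then show "Poly_Mapping.lookup r x * lin (\<lambda>y. if x + y = a + b then 1 else 0) s =
         Poly_Mapping.lookup r x * (if x = a then Poly_Mapping.lookup s b else 0)"
        by (simp add: lin_delta)
    qed
    also have "\<dots> = Poly_Mapping.lookup r a * Poly_Mapping.lookup s b"
      by (rule lin_delta)
    also have "\<dots> \<noteq> 0"
      using a b by (simp add: better_def in_keys_iff)
    finally have "lin (\<lambda>y. if y = a + b then 1 else 0) (xvar i - 1) \<noteq> 0"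
      unfolding rs .
    \<comment> \<open>The coefficient at \<open>a + b\<close> is nonzero, so \<open>a + b\<close> is
      one of the two monomials of \<open>xvar i - 1\<close>, and neither of them involves the
      \<open>k\<close>-th variable.\<close>
    then have "a + b = Poly_Mapping.single i 1 \<or> a + b = 0"
      by (auto simp: lin_minus xvar_def)
    then have "Poly_Mapping.lookup (a + b) k = 0"
      using \<open>k \<noteq> i\<close> by (auto simp: lookup_single)
    then have "Poly_Mapping.lookup a k + Poly_Mapping.lookup b k = 0"
      by (simp add: lookup_add)
    moreover have "\<forall>a'\<in>Poly_Mapping.keys r. c * Poly_Mapping.lookup a' k \<le> c * Poly_Mapping.lookup a k"
      "\<forall>b'\<in>Poly_Mapping.keys s. c * Poly_Mapping.lookup b' k \<le> c * Poly_Mapping.lookup b k"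
      "a \<in> Poly_Mapping.keys r" "b \<in> Poly_Mapping.keys s"
      using a b by (force simp: better_def)+
    ultimately show ?thesis by (intro bexI[of _ a] bexI[of _ b] conjI)
  qed
  let ?le = "\<lambda>c p a. \<forall>a'\<in>Poly_Mapping.keys p. c * Poly_Mapping.lookup a' k \<le> (c::int) * Poly_Mapping.lookup a k"
  \<comment> \<open>The value \<open>c = 1\<close> yields the largest exponents, attained at
    \<open>u\<close> and \<open>v\<close>; \<open>c = - 1\<close> will yield the smallest ones, at
    \<open>u'\<close> and \<open>v'\<close>.\<close>
  obtain u v where uv: "v \<in> Poly_Mapping.keys s" "?le 1 r u \<and> ?le 1 s v \<and>
      Poly_Mapping.lookup u k + Poly_Mapping.lookup v k = 0"
    using top[of 1] by (elim bexE)
  have u: "Poly_Mapping.lookup c k \<le> Poly_Mapping.lookup u k" if "c \<in> Poly_Mapping.keys r" for c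
    using bspec[OF conjunct1[OF uv(2)] that] by simp
  have v: "Poly_Mapping.lookup c k \<le> Poly_Mapping.lookup v k" if "c \<in> Poly_Mapping.keys s" for c
    using bspec[OF conjunct1[OF conjunct2[OF uv(2)]] that] by simp
  obtain u' v' where uv': "v' \<in> Poly_Mapping.keys s" "?le (- 1) r u' \<and> ?le (- 1) s v' \<and>
      Poly_Mapping.lookup u' k + Poly_Mapping.lookup v' k = 0"
    using top[of "- 1"] by (elim bexE)
  have u': "Poly_Mapping.lookup u' k \<le> Poly_Mapping.lookup c k" if "c \<in> Poly_Mapping.keys r" for c
    using bspec[OF conjunct1[OF uv'(2)] that] by simp
  \<comment> \<open>Here \<open>p\<close>, \<open>q\<close> are the largest and \<open>p'\<close>,
    \<open>q'\<close> the smallest exponents in \<open>r\<close>, \<open>s\<close>. From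
    \<open>q' \<le> q\<close> and the two zero sums follows \<open>p \<le> p'\<close>, which
    squeezes everything in between.\<close>
  have "x = y" if "p + q = 0" "p' + q' = 0" "q' \<le> q" "x \<le> p" "y \<le> p" "p' \<le> x" "p' \<le> y" for x y p q p' q' :: int
    using that by linarith
  from this[OF conjunct2[OF conjunct2[OF uv(2)]] conjunct2[OF conjunct2[OF uv'(2)]] v[OF uv'(1)]
    u[OF ab(1)] u[OF ab(2)] u'[OF ab(1)] u'[OF ab(2)]]
  show ?thesis .
qed

text \<open>Each variable differs from the \<open>i\<close>-th or from the \<open>j\<close>-th one,
  so all monomials of \<open>r\<close> agree in every exponent and there is only one. Its
  coefficient divides the constant term -1 of \<open>xvar i - 1\<close>.\<close>

lemma unit_of_common_divisor:
  fixes r :: za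
  assumes "r * s = xvar i - 1" "r * t = xvar j - 1" "i \<noteq> j"
  obtains a where "a \<in> Poly_Mapping.keys r" "r = frag_of a \<or> r = - frag_of a"
proof -
  have "r \<noteq> 0"
    using arg_cong[OF assms(1), of "D1 i"] by (auto simp: lin_minus)
  then obtain a where a: "a \<in> Poly_Mapping.keys r" by fastforce
  have "b = a" if b: "b \<in> Poly_Mapping.keys r" for b
  proof (rule poly_mapping_eqI)
    fix k
    show "Poly_Mapping.lookup b k = Poly_Mapping.lookup a k"
      using factor_of_xvar_minus_1_keys[OF assms(1) _ b a, of k]
        factor_of_xvar_minus_1_keys[OF assms(2) _ b a, of k] assms(3) by metis
  qed
  then have keys: "Poly_Mapping.keys r = {a}" using a by blast
  let ?m = "Poly_Mapping.lookup r a"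
  \<comment> \<open>The constant term of \<open>r * s\<close>, computed in two ways.\<close>
  have "lin (\<lambda>y. if y = 0 then 1 else 0) (r * s) = ?m * lin (\<lambda>b. if a + b = 0 then 1 else 0) s"
    unfolding lin_mult lin_def[of _ r] keys by simp
  moreover have "lin (\<lambda>y. if y = 0 then 1 else 0) (r * s) = - 1"
    unfolding assms(1) xvar_def lin_minus lin_frag_of lin_1
    by (simp add: poly_mapping_eq_iff fun_eq_iff lookup_single)
  ultimately have "?m dvd -1" by (metis dvd_triv_left)
  then have "?m = 1 \<or> ?m = -1" by auto
  moreover have "r = frag_cmul ?m (frag_of a)"
  proof (rule poly_mapping_eqI)
    fix b
    have "b \<noteq> a \<Longrightarrow> Poly_Mapping.lookup r b = 0"
      using keys by (simp flip: not_in_keys_iff_lookup_eq_zero)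
    then show "Poly_Mapping.lookup r b = Poly_Mapping.lookup (frag_cmul ?m (frag_of a)) b"
      by (cases "b = a") (simp_all add: lookup_single)
  qed
  ultimately have "r = frag_of a \<or> r = - frag_of a"
    by (elim disjE) simp_all
  then show ?thesis by (rule that[OF a])
qed

section \<open>Finitely generated ideals of the group ring\<close>

text \<open>The set from \<open>delta_primitive\<close> with arbitrary generators, so that the
  ideals of two families can be compared.\<close>

definition genideal_ZA :: "nat \<Rightarrow> (nat \<Rightarrow> za) \<Rightarrow> za set" where
  "genideal_ZA n g = {\<Sum>i<n. r i * g i | r. \<forall>i<n. r i \<in> ZA n}"

lemma genideal_ZA_I: "(\<And>i. i < n \<Longrightarrow> r i \<in> ZA n) \<Longrightarrow> (\<Sum>i<n. r i * g i) \<in> genideal_ZA n g"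
  by (auto simp: genideal_ZA_def)

lemma genideal_ZA_E:
  assumes "p \<in> genideal_ZA n g"
  obtains r where "\<forall>i<n. r i \<in> ZA n" "p = (\<Sum>i<n. r i * g i)"
  using assms by (auto simp: genideal_ZA_def)

lemma genideal_ZA_0 [simp]: "0 \<in> genideal_ZA n g"
  using genideal_ZA_I[of n "\<lambda>_. 0" g] by simp

lemma genideal_ZA_add:
  assumes "p \<in> genideal_ZA n g" "q \<in> genideal_ZA n g" shows "p + q \<in> genideal_ZA n g"
proof -
  obtain r where r: "\<forall>i<n. r i \<in> ZA n" "p = (\<Sum>i<n. r i * g i)"
    using assms(1) by (rule genideal_ZA_E)
  obtain s where s: "\<forall>i<n. s i \<in> ZA n" "q = (\<Sum>i<n. s i * g i)"
    using assms(2) by (rule genideal_ZA_E)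
  have "p + q = (\<Sum>i<n. (r i + s i) * g i)"
    by (simp add: r(2) s(2) ring_distribs sum.distrib)
  also have "\<dots> \<in> genideal_ZA n g"
    using r(1) s(1) by (intro genideal_ZA_I ZA_add) auto
  finally show ?thesis .
qed

lemma genideal_ZA_mult:
  assumes "p \<in> genideal_ZA n g" "c \<in> ZA n" shows "c * p \<in> genideal_ZA n g"
proof -
  obtain r where r: "\<forall>i<n. r i \<in> ZA n" "p = (\<Sum>i<n. r i * g i)"
    using assms(1) by (rule genideal_ZA_E)
  have "c * p = (\<Sum>i<n. (c * r i) * g i)"
    by (simp add: r(2) sum_distrib_left mult.assoc)
  also have "\<dots> \<in> genideal_ZA n g"
    using assms(2) r(1) by (intro genideal_ZA_I ZA_mult) auto
  finally show ?thesis .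
qed

lemma genideal_ZA_uminus: "p \<in> genideal_ZA n g \<Longrightarrow> - p \<in> genideal_ZA n g"
  using genideal_ZA_mult[of p n g "- 1"] by (simp add: ZA_uminus)

lemma genideal_ZA_minus:
  "p \<in> genideal_ZA n g \<Longrightarrow> q \<in> genideal_ZA n g \<Longrightarrow> p - q \<in> genideal_ZA n g"
  using genideal_ZA_add[of p n g "- q"] by (simp add: genideal_ZA_uminus)

lemma genideal_ZA_generator:
  assumes "i < n" shows "g i \<in> genideal_ZA n g"
proof -
  have "(\<Sum>j<n. (if j = i then 1 else 0) * g j) \<in> genideal_ZA n g"
    by (rule genideal_ZA_I) simp
  also have "(\<Sum>j<n. (if j = i then 1 else 0) * g j) = g i"
    using assms by (subst sum.mono_neutral_right[of _ "{i}"]) auto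
  finally show ?thesis .
qed

lemma genideal_ZA_sum:
  "(\<And>i. i \<in> I \<Longrightarrow> f i \<in> genideal_ZA n g) \<Longrightarrow> sum f I \<in> genideal_ZA n g"
  by (induction I rule: infinite_finite_induct) (auto intro: genideal_ZA_add)

lemma genideal_ZA_subset:
  assumes "\<And>i. i < n \<Longrightarrow> g i \<in> genideal_ZA n g'"
  shows "genideal_ZA n g \<subseteq> genideal_ZA n g'"
proof
  fix p assume "p \<in> genideal_ZA n g"
  then obtain r where r: "\<forall>i<n. r i \<in> ZA n" "p = (\<Sum>i<n. r i * g i)"
    by (rule genideal_ZA_E)
  show "p \<in> genideal_ZA n g'"
    unfolding r(2) using assms r(1) by (intro genideal_ZA_sum genideal_ZA_mult) auto
qed

lemma genideal_ZA_subset_DeltaA: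
  assumes "\<And>i. i < n \<Longrightarrow> g i \<in> DeltaA n"
  shows "genideal_ZA n g \<subseteq> DeltaA n"
proof
  fix p assume "p \<in> genideal_ZA n g"
  then obtain r where r: "\<forall>i<n. r i \<in> ZA n" "p = (\<Sum>i<n. r i * g i)"
    by (rule genideal_ZA_E)
  have g: "g i \<in> ZA n \<and> augm (g i) = 0" if "i < n" for i
    using assms[OF that] unfolding DeltaA_def by blast
  have "p \<in> ZA n"
    unfolding r(2) by (intro ZA_sum ZA_mult) (use r(1) g in blast)+
  moreover have "augm p = (\<Sum>i<n. augm (r i) * augm (g i))"
    unfolding r(2) by simp
  moreover have "\<dots> = 0"
    by (intro sum.neutral ballI) (use g in simp)
  ultimately show "p \<in> DeltaA n"
    unfolding DeltaA_def by simp
qed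

section \<open>Words and the free group\<close>

abbreviation lexp :: "nat \<times> bool \<Rightarrow> nat \<Rightarrow>\<^sub>0 int" where
  "lexp l \<equiv> Poly_Mapping.single (fst l) (if snd l then -1 else 1)"

text \<open>The image of a word in the free Abelian group, written additively as an exponent
  vector.\<close>

primrec wab :: "fword \<Rightarrow> nat \<Rightarrow>\<^sub>0 int" where
  "wab [] = 0"
| "wab (l # w) = lexp l + wab w"

definition winv :: "fword \<Rightarrow> fword" where
  "winv w = rev (map (map_prod id Not) w)"

lemma winv_simps [simp]: "winv [] = []" "winv (l # w) = winv w @ [map_prod id Not l]"
  by (simp_all add: winv_def)

lemma wab_append [simp]: "wab (u @ v) = wab u + wab v"
  by (induction u) (auto simp: add.assoc)

lemma wab_winv [simp]: "wab (winv w) = - wab w"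
  by (induction w) (auto simp: single_uminus)

lemma fox_append: "fox i (u @ v) = fox i u + frag_of (wab u) * fox i v"
  by (induction u) (auto simp: letter_mono_def frag_of_add algebra_simps)

lemma fwords_simps [simp]: "[] \<in> fwords n" "l # w \<in> fwords n \<longleftrightarrow> fst l < n \<and> w \<in> fwords n"
  "u @ v \<in> fwords n \<longleftrightarrow> u \<in> fwords n \<and> v \<in> fwords n"
  by (auto simp: fwords_def)

lemma winv_fwords [simp]: "winv w \<in> fwords n \<longleftrightarrow> w \<in> fwords n"
  by (induction w) auto

lemma fox_ZA: "w \<in> fwords n \<Longrightarrow> fox i w \<in> ZA n"
  by (induction w) (auto simp: letter_mono_def intro!: ZA_add ZA_mult ZA_uminus ZA_minus)

text \<open>The prefix monomials have augmentation 1, so what remains is the signed count of the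
  occurrences of the \<open>i\<close>-th generator.\<close>

lemma augm_fox: "augm (fox i w) = Poly_Mapping.lookup (wab w) i"
  by (induction w) (auto simp: letter_mono_def lookup_add lookup_single)

text \<open>This is the abelianized form of the identity that characterizes Fox derivatives. It
  holds for one letter, with -x^-1 (x - 1) = x^-1 - 1 in the inverse case, and the product rule
  carries it along the word.\<close>

lemma fox_fundamental:
  assumes "w \<in> fwords n"
  shows "(\<Sum>i<n. fox i w * (xvar i - 1)) = frag_of (wab w) - 1"
  using assms
proof (induction w)
  case (Cons l w)
  have l: "fst l < n" using Cons.prems by simp
  let ?d = "\<lambda>i. if fst l = i then if snd l then - letter_mono l else 1 else 0"
  have "(\<Sum>i<n. ?d i * (xvar i - 1)) = ?d (fst l) * (xvar (fst l) - 1)"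
    using l by (subst sum.mono_neutral_right[of _ "{fst l}"]) auto
  also have "\<dots> = letter_mono l - 1"
    by (auto simp: letter_mono_def xvar_def right_diff_distrib mult_single simp flip: single_add)
  finally have "(\<Sum>i<n. ?d i * (xvar i - 1)) = letter_mono l - 1" .
  moreover have "(\<Sum>i<n. fox i (l # w) * (xvar i - 1)) =
      (\<Sum>i<n. ?d i * (xvar i - 1)) + letter_mono l * (\<Sum>i<n. fox i w * (xvar i - 1))"
    by (simp only: fox.simps distrib_right sum.distrib sum_distrib_left mult.assoc)
  ultimately show ?case
    using Cons by (simp add: right_diff_distrib letter_mono_def frag_of_add)
qed simp

lemma wab_keys: "w \<in> fwords n \<Longrightarrow> Poly_Mapping.keys (wab w) \<subseteq> {..<n}"
proof (induction w)
  case (Cons l w)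
  then show ?case using keys_add[of "lexp l" "wab w"] by auto
qed simp

lemma wab_surj:
  assumes "Poly_Mapping.keys a \<subseteq> {..<n}"
  shows "\<exists>w\<in>fwords n. wab w = a"
  using assms
proof (induction a rule: frag_induction)
  case zero
  show ?case by (rule bexI[of _ "[]"]) auto
next
  case (one i)
  then show ?case by (intro bexI[of _ "[(i, False)]"]) auto
next
  case (diff a b)
  then obtain u v where "u \<in> fwords n" "wab u = a" "v \<in> fwords n" "wab v = b" by blast
  then show ?case by (intro bexI[of _ "u @ winv v"]) auto
qed

text \<open>An element of augmentation 0 is a combination of differences a - 1 of monomials. Each
  monomial is the image of a word, and Fox's formula for that word places a - 1 in the
  ideal.\<close>

lemma DeltaA_subset_genideal: "DeltaA n \<subseteq> genideal_ZA n (\<lambda>i. xvar i - 1)"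
proof
  fix p assume "p \<in> DeltaA n"
  then have p: "Poly_Mapping.keys p \<subseteq> {a. Poly_Mapping.keys a \<subseteq> {..<n}}" and p0: "augm p = 0"
    by (simp_all add: DeltaA_def ZA_iff)
  let ?I = "genideal_ZA n (\<lambda>i. xvar i - 1)"
  \<comment> \<open>Subtracting the augmentation gives a claim that is additive in \<open>p\<close>
    and makes sense for every \<open>p\<close>, so that the induction can start from
    monomials.\<close>
  have "p - of_int (augm p) \<in> ?I"
    using p
  proof (induction p rule: frag_induction)
    case (one a)
    then obtain w where w: "w \<in> fwords n" "wab w = a" using wab_surj by blast
    have "(\<Sum>i<n. fox i w * (xvar i - 1)) \<in> ?I"
      by (intro genideal_ZA_I fox_ZA w)
    then show ?case using fox_fundamental[OF w(1)] w(2) by simp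
  next
    case (diff a b)
    from genideal_ZA_minus[OF diff] show ?case by (simp add: algebra_simps)
  qed simp
  with p0 show "p \<in> ?I" by simp
qed

lemma xvar_minus_1_DeltaA: "i < n \<Longrightarrow> xvar i - 1 \<in> DeltaA n"
  by (simp add: DeltaA_def ZA_minus xvar_ZA)

section \<open>Free reduction and the free group\<close>

lemma fred_invariants:
  assumes "fred u v" shows "wab u = wab v" "fox i u = fox i v"
  using assms
  by (auto elim!: fred.cases simp: fox_append letter_mono_def mult_single algebra_simps
      simp flip: single_add)

lemma fequiv_refl [simp]: "fequiv u u"
  by (simp add: fequiv_def)

lemma fequiv_trans: "fequiv u v \<Longrightarrow> fequiv v w \<Longrightarrow> fequiv u w"
  by (simp add: fequiv_def)

lemma fequiv_sym: "fequiv u v \<Longrightarrow> fequiv v u"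
  unfolding fequiv_def by (rule sympD[OF symp_rtranclp]) (auto intro!: sympI)

lemma fequiv_fred: "fred u v \<Longrightarrow> fequiv u v"
  by (auto simp: fequiv_def)

text \<open>With symmetry and transitivity as separate cases, an invariant has to be checked only
  for a single cancellation.\<close>

lemma fequiv_induct [consumes 1, case_names refl fred sym trans]:
  assumes "fequiv u v" "\<And>u. P u u" "\<And>u v. fred u v \<Longrightarrow> P u v" "\<And>u v. P u v \<Longrightarrow> P v u"
    "\<And>u v w. P u v \<Longrightarrow> P v w \<Longrightarrow> P u w"
  shows "P u v"
  using assms(1) unfolding fequiv_def
proof (induction rule: rtranclp_induct)
  case (step v w)
  then have "P v w" using assms(3,4) by auto
  with step.IH show ?case using assms(5) by blast
qed (rule assms(2))

lemma fequiv_invariants: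
  assumes "fequiv u v" shows "wab u = wab v" "fox i u = fox i v"
  using assms by (induction rule: fequiv_induct) (auto dest: fred_invariants)

lemma fequiv_append_left: "fequiv u v \<Longrightarrow> fequiv (w @ u) (w @ v)"
proof (induction rule: fequiv_induct)
  case (fred u v)
  then show ?case
  proof cases
    case (1 x i b y)
    then show ?thesis using fequiv_fred[OF fred.intros[of "w @ x" i b y]] by simp
  qed
qed (auto intro: fequiv_sym fequiv_trans)

lemma fequiv_append_right: "fequiv u v \<Longrightarrow> fequiv (u @ w) (v @ w)"
proof (induction rule: fequiv_induct)
  case (fred u v)
  then show ?case
  proof cases
    case (1 x i b y)
    then show ?thesis using fequiv_fred[OF fred.intros[of x i b "y @ w"]] by simp
  qed
qed (auto intro: fequiv_sym fequiv_trans)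

lemma fequiv_winv_left: "fequiv (winv w @ w) []"
proof (induction w)
  case (Cons l w)
  have "fequiv (winv w @ [map_prod id Not l, l] @ w) (winv w @ w)"
    using fequiv_fred[OF fred.intros[of "winv w" "fst l" "\<not> snd l" w]]
    by (cases l) auto
  with Cons show ?case by (auto intro: fequiv_trans)
qed simp

lemma fclass_eq_iff: "fclass u = fclass v \<longleftrightarrow> fequiv u v"
  unfolding fclass_def by (auto intro: fequiv_sym fequiv_trans)

lemma fclass_memD: "v \<in> fclass u \<Longrightarrow> fclass v = fclass u"
  by (metis fclass_eq_iff fclass_def mem_Collect_eq)

lemma fclass_self: "u \<in> fclass u"
  by (simp add: fclass_def)

lemma FG_carrier: "carrier (FG n) = fclass ` fwords n"
  and FG_one: "\<one>\<^bsub>FG n\<^esub> = fclass []"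
  by (simp_all add: FG_def)

text \<open>The product in \<open>FG\<close> is defined by chosen representatives; the choice is
  immaterial because \<open>fequiv\<close> is a congruence for concatenation.\<close>

lemma FG_mult [simp]: "fclass u \<otimes>\<^bsub>FG n\<^esub> fclass v = fclass (u @ v)"
proof -
  have "(SOME w. w \<in> fclass u) \<in> fclass u" for u
    by (rule someI) (rule fclass_self)
  then have "fequiv u (SOME w. w \<in> fclass u)" for u
    unfolding fclass_def by blast
  then have "fequiv (u @ v) ((SOME w. w \<in> fclass u) @ (SOME w. w \<in> fclass v))"
    by (blast intro: fequiv_trans fequiv_append_left fequiv_append_right)
  then show ?thesis
    by (simp add: FG_def flip: fclass_eq_iff)
qed

lemma FG_group: "group (FG n)"
proof (rule groupI)
  fix x assume "x \<in> carrier (FG n)"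
  then obtain w where w: "w \<in> fwords n" "x = fclass w" by (auto simp: FG_carrier)
  then show "\<exists>y\<in>carrier (FG n). y \<otimes>\<^bsub>FG n\<^esub> x = \<one>\<^bsub>FG n\<^esub>"
    by (intro bexI[of _ "fclass (winv w)"]) (auto simp: FG_carrier FG_one fclass_eq_iff fequiv_winv_left)
qed (auto simp: FG_carrier FG_one)

lemma FG_inv:
  assumes "w \<in> fwords n" shows "inv\<^bsub>FG n\<^esub> (fclass w) = fclass (winv w)"
proof (rule group.inv_equality[OF FG_group])
  show "fclass (winv w) \<otimes>\<^bsub>FG n\<^esub> fclass w = \<one>\<^bsub>FG n\<^esub>"
    by (simp add: FG_one fclass_eq_iff fequiv_winv_left)
qed (use assms in \<open>auto simp: FG_carrier\<close>)

lemma FG2_normal: "FG2 n \<lhd> FG n"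
  unfolding FG2_def
  by (intro group.derived_is_normal group.derived_self_is_normal FG_group)

text \<open>Apply the product rule to \<open>winv w @ w\<close>, which is equivalent to the empty
  word and so has derivative 0.\<close>

lemma fox_winv: "fox i (winv w) = - frag_of (- wab w) * fox i w"
proof -
  have "fox i (winv w @ w) = 0" using fequiv_invariants(2)[OF fequiv_winv_left] by simp
  then show ?thesis by (simp add: fox_append add_eq_0_iff2)
qed

text \<open>The classes of words with property \<open>Q\<close> form a subgroup containing all
  commutators of \<open>H\<close>. Used once for each of the two steps of the derived
  series.\<close>

lemma FG_derived_subset:
  assumes H: "H \<subseteq> fclass ` {w\<in>fwords n. P w}"
    and nil: "Q []" and append: "\<And>u v. Q u \<Longrightarrow> Q v \<Longrightarrow> Q (u @ v)" and winv: "\<And>u. Q u \<Longrightarrow> Q (winv u)"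
    and comm: "\<And>u v. P u \<Longrightarrow> P v \<Longrightarrow> Q (u @ v @ winv u @ winv v)"
  shows "derived (FG n) H \<subseteq> fclass ` {w\<in>fwords n. Q w}"
proof -
  let ?K = "fclass ` {w\<in>fwords n. Q w}"
  interpret group "FG n" by (rule FG_group)
  have "subgroup ?K (FG n)"
  proof (rule subgroupI)
    show "?K \<noteq> {}" using nil by force
  qed (auto simp: FG_carrier FG_inv append winv)
  moreover have "derived_set (FG n) H \<subseteq> ?K"
  proof
    fix x assume "x \<in> derived_set (FG n) H"
    then obtain g h where "g \<in> H" "h \<in> H"
      "x = g \<otimes>\<^bsub>FG n\<^esub> h \<otimes>\<^bsub>FG n\<^esub> inv\<^bsub>FG n\<^esub> g \<otimes>\<^bsub>FG n\<^esub> inv\<^bsub>FG n\<^esub> h" by blast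
    moreover from this(1,2) H obtain u v where "g = fclass u" "h = fclass v"
      "u \<in> fwords n" "v \<in> fwords n" "P u" "P v" by blast
    ultimately show "x \<in> ?K"
      by (auto simp: FG_inv comm intro!: image_eqI[of _ _ "u @ v @ winv u @ winv v"])
  qed
  ultimately show ?thesis
    unfolding derived_def by (intro generate_subgroup_incl)
qed

text \<open>On words with exponent vector 0 the product rule makes \<open>fox i\<close> additive,
  hence zero on their commutators. This is what makes the derivatives well defined on cosets of
  \<open>FG2 n\<close>.\<close>

lemma FG2_subset: "FG2 n \<subseteq> fclass ` {w\<in>fwords n. wab w = 0 \<and> (\<forall>i. fox i w = 0)}"
  unfolding FG2_def
proof (rule FG_derived_subset)
  show "derived (FG n) (carrier (FG n)) \<subseteq> fclass ` {w\<in>fwords n. wab w = 0}"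
    by (rule FG_derived_subset[where P = "\<lambda>_. True"]) (auto simp: FG_carrier)
qed (auto simp: fox_append fox_winv)

section \<open>The free metabelian group\<close>

definition pr :: "nat \<Rightarrow> fword \<Rightarrow> fword set set" where
  "pr n w = FG2 n #>\<^bsub>FG n\<^esub> fclass w"

lemma mgen_eq_pr: "mgen n i = pr n [(i, False)]"
  by (simp add: mgen_def pr_def)

lemma MG_group: "group (MG n)"
  unfolding MG_def by (rule normal.factorgroup_is_group[OF FG2_normal])

lemma MG_carrier: "carrier (MG n) = pr n ` fwords n"
  by (auto simp: MG_def carrier_FactGroup FG_carrier pr_def)

lemma pr_carrier: "w \<in> fwords n \<Longrightarrow> pr n w \<in> carrier (MG n)"
  by (simp add: MG_carrier)

lemma pr_append:
  assumes "u \<in> fwords n" "v \<in> fwords n"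
  shows "pr n (u @ v) = pr n u \<otimes>\<^bsub>MG n\<^esub> pr n v"
proof -
  have "fclass u \<in> carrier (FG n)" "fclass v \<in> carrier (FG n)"
    using assms by (auto simp: FG_carrier)
  then show ?thesis
    by (simp add: pr_def MG_def normal.rcos_sum[OF FG2_normal])
qed

lemma pr_Nil: "pr n [] = \<one>\<^bsub>MG n\<^esub>"
proof -
  have "FG2 n \<subseteq> carrier (FG n)"
    using FG2_subset by (force simp: FG_carrier)
  then have "FG2 n #>\<^bsub>FG n\<^esub> \<one>\<^bsub>FG n\<^esub> = FG2 n"
    by (rule group.coset_mult_one[OF FG_group])
  then show ?thesis
    by (simp add: pr_def MG_def FG_one)
qed

lemma pr_eqI:
  assumes "fequiv u v" shows "pr n u = pr n v"
  using assms by (simp add: pr_def fclass_eq_iff[THEN iffD2])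

lemma pr_winv:
  assumes "w \<in> fwords n" shows "pr n (winv w) = inv\<^bsub>MG n\<^esub> (pr n w)"
proof -
  have "pr n (winv w) \<otimes>\<^bsub>MG n\<^esub> pr n w = \<one>\<^bsub>MG n\<^esub>"
    using assms pr_eqI[OF fequiv_winv_left, of n w] by (simp add: pr_Nil flip: pr_append)
  then show ?thesis
    using assms by (intro group.inv_equality[OF MG_group, symmetric] pr_carrier) simp_all
qed

text \<open>The two words differ by a left factor from the second derived subgroup, which affects
  neither the exponents nor the derivatives. Independence of the preimage follows.\<close>

lemma pr_memD:
  assumes "fclass u \<in> pr n v"
  shows "wab u = wab v" "fox i u = fox i v"
proof -
  obtain w where w: "wab w = 0" "\<And>i. fox i w = 0" "fclass u = fclass w \<otimes>\<^bsub>FG n\<^esub> fclass v"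
    using assms FG2_subset[of n] unfolding pr_def r_coset_def by blast
  then have "fequiv u (w @ v)"
    by (simp add: fclass_eq_iff)
  from fequiv_invariants[OF this] w show "wab u = wab v" "fox i u = fox i v"
    by (simp_all add: fox_append)
qed

lemma fclass_mem_pr: "w \<in> fwords n \<Longrightarrow> fclass w \<in> pr n w"
  unfolding pr_def
  by (intro group.rcos_self[OF FG_group] normal_imp_subgroup[OF FG2_normal])
    (auto simp: FG_carrier)

lemma mfox_pr:
  assumes "w \<in> fwords n" shows "mfox n i (pr n w) = fox i w"
proof -
  let ?u = "SOME w'. w' \<in> \<Union>(pr n w) \<inter> fwords n"
  have "w \<in> \<Union>(pr n w) \<inter> fwords n"
    using assms fclass_mem_pr fclass_self by blast
  then have "?u \<in> \<Union>(pr n w) \<inter> fwords n" by (rule someI)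
  then obtain A where A: "A \<in> pr n w" "?u \<in> A" by blast
  \<comment> \<open>An element of \<open>MG n\<close> is a set of classes; a class containing the
    chosen word is the class of that word, so \<open>pr_memD\<close> applies to it.\<close>
  have "pr n w \<subseteq> carrier (FG n)"
    unfolding pr_def using assms normal_imp_subgroup[OF FG2_normal, of n]
    by (intro monoid.r_coset_subset_G group.is_monoid FG_group) (auto simp: FG_carrier subgroup_def)
  with A obtain v where "A = fclass v" by (auto simp: FG_carrier)
  with A have "fclass ?u \<in> pr n w" using fclass_memD by metis
  then show ?thesis unfolding mfox_def by (rule pr_memD)
qed

text \<open>The abelianization map of the free metabelian group, evaluated at a chosen preimage word
  as in \<open>mfox\<close>.\<close>

definition mab :: "nat \<Rightarrow> fword set set \<Rightarrow> nat \<Rightarrow>\<^sub>0 int" where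
  "mab n h = wab (SOME w. w \<in> fwords n \<and> pr n w = h)"

lemma mab_pr:
  assumes "w \<in> fwords n" shows "mab n (pr n w) = wab w"
proof -
  let ?u = "SOME u. u \<in> fwords n \<and> pr n u = pr n w"
  have "?u \<in> fwords n \<and> pr n ?u = pr n w"
    by (rule someI[of _ w]) (simp add: assms)
  then have "fclass ?u \<in> pr n w" using fclass_mem_pr by metis
  then show ?thesis unfolding mab_def by (rule pr_memD)
qed

lemma MG_cases:
  assumes "h \<in> carrier (MG n)"
  obtains w where "w \<in> fwords n" "h = pr n w"
  using assms by (auto simp: MG_carrier)

lemma mab_mult:
  assumes "g \<in> carrier (MG n)" "h \<in> carrier (MG n)"
  shows "mab n (g \<otimes>\<^bsub>MG n\<^esub> h) = mab n g + mab n h"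
  using assms by (auto elim!: MG_cases simp: mab_pr simp flip: pr_append)

lemma mfox_mult:
  assumes "g \<in> carrier (MG n)" "h \<in> carrier (MG n)"
  shows "mfox n i (g \<otimes>\<^bsub>MG n\<^esub> h) = mfox n i g + frag_of (mab n g) * mfox n i h"
  using assms by (auto elim!: MG_cases simp: mfox_pr mab_pr fox_append simp flip: pr_append)

lemma mab_inv: "g \<in> carrier (MG n) \<Longrightarrow> mab n (inv\<^bsub>MG n\<^esub> g) = - mab n g"
  by (auto elim!: MG_cases simp: mab_pr simp flip: pr_winv)

lemma mfox_inv:
  "g \<in> carrier (MG n) \<Longrightarrow> mfox n i (inv\<^bsub>MG n\<^esub> g) = - frag_of (- mab n g) * mfox n i g"
  by (auto elim!: MG_cases simp: mab_pr mfox_pr fox_winv simp flip: pr_winv)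

lemma mab_one: "mab n \<one>\<^bsub>MG n\<^esub> = 0"
  and mfox_one: "mfox n i \<one>\<^bsub>MG n\<^esub> = 0"
  by (simp_all add: mab_pr mfox_pr flip: pr_Nil)

lemma mab_mgen: "i < n \<Longrightarrow> mab n (mgen n i) = Poly_Mapping.single i 1"
  and mfox_mgen: "i < n \<Longrightarrow> mfox n j (mgen n i) = (if i = j then 1 else 0)"
  and mgen_carrier: "i < n \<Longrightarrow> mgen n i \<in> carrier (MG n)"
  by (simp_all add: mgen_eq_pr mab_pr mfox_pr pr_carrier)

lemma mfox_ZA: "h \<in> carrier (MG n) \<Longrightarrow> mfox n i h \<in> ZA n"
  by (auto elim!: MG_cases simp: mfox_pr fox_ZA)

lemma augm_mfox: "h \<in> carrier (MG n) \<Longrightarrow> augm (mfox n i h) = Poly_Mapping.lookup (mab n h) i"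
  by (auto elim!: MG_cases simp: mfox_pr mab_pr augm_fox)

lemma mfox_fundamental:
  "h \<in> carrier (MG n) \<Longrightarrow> (\<Sum>i<n. mfox n i h * (xvar i - 1)) = frag_of (mab n h) - 1"
  by (auto elim!: MG_cases simp: mfox_pr mab_pr fox_fundamental)

lemma mab_keys: "h \<in> carrier (MG n) \<Longrightarrow> Poly_Mapping.keys (mab n h) \<subseteq> {..<n}"
  by (elim MG_cases) (simp add: mab_pr wab_keys)

lemma mab_surj:
  assumes "Poly_Mapping.keys a \<subseteq> {..<n}" obtains g where "g \<in> carrier (MG n)" "mab n g = a"
  using wab_surj[OF assms] mab_pr pr_carrier by metis

lemma mfox_DeltaA:
  "h \<in> carrier (MG n) \<Longrightarrow> mab n h = 0 \<Longrightarrow> mfox n i h \<in> DeltaA n"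
  by (simp add: DeltaA_def mfox_ZA augm_mfox)

lemma delta_primitive_iff:
  "delta_primitive n h \<longleftrightarrow>
     h \<in> carrier (MG n) \<and> genideal_ZA n (\<lambda>i. mfox n i h) = DeltaA n"
  by (simp add: delta_primitive_def genideal_ZA_def)

text \<open>The exponents of \<open>h\<close> are the augmentations of its derivatives, and these
  derivatives belong to the augmentation ideal.\<close>

lemma delta_primitive_mab:
  assumes "delta_primitive n h" shows "mab n h = 0"
proof (rule poly_mapping_eqI)
  fix i
  have h: "h \<in> carrier (MG n)" using assms by (simp add: delta_primitive_iff)
  show "Poly_Mapping.lookup (mab n h) i = Poly_Mapping.lookup 0 i"
  proof (cases "i < n")
    case True
    then have "mfox n i h \<in> DeltaA n"
      using assms genideal_ZA_generator[of i n "\<lambda>i. mfox n i h"] by (simp add: delta_primitive_iff)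
    then show ?thesis using augm_mfox[OF h, of i] by (simp add: DeltaA_def)
  next
    case False
    then have "i \<notin> Poly_Mapping.keys (mab n h)" using mab_keys[OF h] by auto
    then show ?thesis by (simp add: in_keys_iff)
  qed
qed

section \<open>Skew-symmetric matrices and odd rank\<close>

lemma det_skew_symmetric_odd:
  fixes B :: "int mat"
  assumes B: "B \<in> carrier_mat n n" and skew: "transpose_mat B = - 1 \<cdot>\<^sub>m B" and "odd n"
  shows "det B = 0"
proof -
  have "det B = det (- 1 \<cdot>\<^sub>m B)" using det_transpose[OF B] skew by simp
  also have "\<dots> = - det B" using B \<open>odd n\<close> by simp
  finally show ?thesis by simp
qed

lemma no_delta_primitive_odd:
  assumes "odd n" shows "\<not> delta_primitive n h"
proof
  assume dp: "delta_primitive n h"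
  then have h: "h \<in> carrier (MG n)" by (simp add: delta_primitive_iff)
  let ?d = "\<lambda>i. mfox n i h"
  have augm: "augm (?d i) = 0" for i
    by (simp add: augm_mfox[OF h] delta_primitive_mab[OF dp])
  have skew: "D1 k (?d j) = - D1 j (?d k)" if "j < n" "k < n" for j k
  proof -
    have "(\<Sum>i<n. ?d i * (xvar i - 1)) = 0"
      by (simp add: mfox_fundamental[OF h] delta_primitive_mab[OF dp])
    then have "0 = (\<Sum>i<n. D2 j k (?d i * (xvar i - 1)))"
      by (simp flip: lin_sum)
    \<comment> \<open>Both \<open>?d i\<close> and \<open>xvar i - 1\<close> have augmentation 0, so
      only the two mixed terms of \<open>D2_mult\<close> survive.\<close>
    also have "\<dots> = (\<Sum>i<n. (if i = k then D1 j (?d k) else 0) + (if i = j then D1 k (?d j) else 0))"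
      by (rule sum.cong) (simp_all add: D2_mult augm lin_minus)
    also have "\<dots> = D1 j (?d k) + D1 k (?d j)"
      using that by (simp add: sum.distrib)
    finally show ?thesis by simp
  qed
  have "\<forall>j. j < n \<longrightarrow> (\<exists>r. xvar j - 1 = (\<Sum>i<n. r i * ?d i))"
    using dp xvar_minus_1_DeltaA[of _ n] genideal_ZA_E[of _ n ?d] unfolding delta_primitive_iff by metis
  then obtain r where r: "\<And>j. j < n \<Longrightarrow> xvar j - 1 = (\<Sum>i<n. r j i * ?d i)" by metis
  \<comment> \<open>\<open>?B\<close> collects the linear parts of the derivatives, and
    \<open>?R\<close> the augmentations of the coefficients that express \<open>xvar j - 1\<close>
    through them.\<close>
  let ?B = "mat n n (\<lambda>(i, k). D1 k (?d i))" and ?R = "mat n n (\<lambda>(j, i). augm (r j i))"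
  have "?R * ?B = 1\<^sub>m n"
  proof (rule eq_matI)
    fix j k assume jk: "j < dim_row (1\<^sub>m n :: int mat)" "k < dim_col (1\<^sub>m n :: int mat)"
    have "(?R * ?B) $$ (j, k) = (\<Sum>i<n. augm (r j i) * D1 k (?d i))"
      using jk by (simp add: scalar_prod_def atLeast0LessThan)
    \<comment> \<open>The terms with a derivative of \<open>r j i\<close> vanish, since each
      \<open>?d i\<close> has augmentation 0.\<close>
    also have "\<dots> = D1 k (xvar j - 1)"
      using jk by (simp add: r lin_sum D1_mult augm)
    finally show "(?R * ?B) $$ (j, k) = 1\<^sub>m n $$ (j, k)"
      using jk by (simp add: lin_minus)
  qed simp_all
  moreover have "det (?R * ?B) = det ?R * det ?B"
    by (rule det_mult) (rule mat_carrier)+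
  moreover have "det ?B = 0"
  proof (rule det_skew_symmetric_odd)
    show "transpose_mat ?B = - 1 \<cdot>\<^sub>m ?B"
    proof (rule eq_matI)
      fix i k assume "i < dim_row (- 1 \<cdot>\<^sub>m ?B)" "k < dim_col (- 1 \<cdot>\<^sub>m ?B)"
      then show "transpose_mat ?B $$ (i, k) = (- 1 \<cdot>\<^sub>m ?B) $$ (i, k)"
        using skew[of k i] by simp
    qed simp_all
  qed (use assms in simp_all)
  ultimately have "det (1\<^sub>m n :: int mat) = 0" by (metis mult_zero_right)
  then show False by simp
qed

section \<open>The derived subgroup\<close>

abbreviation MD :: "nat \<Rightarrow> fword set set set" where
  "MD n \<equiv> derived (MG n) (carrier (MG n))"

lemma (in group) derived_trivial_commute:
  assumes "H \<subseteq> carrier G" "derived G H = {\<one>}" "x \<in> H" "y \<in> H"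
  shows "x \<otimes> y = y \<otimes> x"
proof -
  have xy: "x \<in> carrier G" "y \<in> carrier G" using assms by auto
  have "x \<otimes> y \<otimes> inv x \<otimes> inv y \<in> derived G H"
    unfolding derived_def using assms(3,4) by (intro generate.incl) blast
  then have "x \<otimes> y \<otimes> inv x \<otimes> inv y = \<one>" using assms(2) by blast
  then have "x \<otimes> y \<otimes> inv x = y" using xy by (metis inv_equality inv_inv inv_closed m_closed)
  then show ?thesis using xy by (metis inv_solve_right' m_closed)
qed

lemma FG_MG_hom: "group_hom (FG n) (MG n) (\<lambda>a. FG2 n #>\<^bsub>FG n\<^esub> a)"
  using FG_group MG_group normal.r_coset_hom_Mod[OF FG2_normal[of n]]
  by (simp add: group_hom_def group_hom_axioms_def MG_def)

text \<open>The quotient map is onto, so it carries the derived series of the free group onto that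
  of \<open>MG n\<close>, and \<open>FG2 n\<close> becomes trivial.\<close>

lemma MG_metabelian: "derived (MG n) (MD n) = {\<one>\<^bsub>MG n\<^esub>}"
proof -
  let ?q = "\<lambda>a. FG2 n #>\<^bsub>FG n\<^esub> a"
  interpret F: group "FG n" by (rule FG_group)
  interpret N: normal "FG2 n" "FG n" by (rule FG2_normal)
  interpret group_hom "FG n" "MG n" ?q by (rule FG_MG_hom)
  have "carrier (MG n) = ?q ` carrier (FG n)"
    by (simp add: MG_def carrier_FactGroup)
  then have "MD n = ?q ` derived (FG n) (carrier (FG n))"
    by (simp add: derived_img)
  then have "derived (MG n) (MD n) = ?q ` FG2 n"
    by (simp add: derived_img F.derived_in_carrier flip: FG2_def)
  also have "\<dots> = (\<lambda>_. FG2 n) ` FG2 n"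
    by (rule image_cong[OF refl]) (rule F.coset_join2[OF N.mem_carrier N.subgroup_axioms])
  also have "\<dots> = {FG2 n}"
    by (rule image_constant[OF N.one_closed])
  finally show ?thesis by (simp add: MG_def)
qed

lemma MD_subset: "MD n \<subseteq> carrier (MG n)"
  by (rule group.derived_in_carrier[OF MG_group]) simp

lemma MD_commute: "x \<in> MD n \<Longrightarrow> y \<in> MD n \<Longrightarrow> x \<otimes>\<^bsub>MG n\<^esub> y = y \<otimes>\<^bsub>MG n\<^esub> x"
  by (rule group.derived_trivial_commute[OF MG_group MD_subset MG_metabelian])

text \<open>Without the inverse of \<open>l\<close>, every occurrence of its generator moves the
  exponent in the direction of \<open>l\<close>.\<close>

lemma inverse_letter_absent:
  assumes "map_prod id Not l \<notin> set w"
  shows "0 \<le> (if snd l then -1 else 1) * Poly_Mapping.lookup (wab w) (fst l)"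
  using assms
proof (induction w)
  case (Cons m w)
  then show ?case
    by (cases l; cases m) (auto simp: lookup_add lookup_single when_def split: if_splits)
qed simp

lemma inverse_letter_ex:
  assumes "wab (l # w) = 0"
  obtains u v where "w = u @ map_prod id Not l # v"
proof -
  have "Poly_Mapping.lookup (wab (l # w)) (fst l) = 0" using assms by simp
  then have "map_prod id Not l \<in> set w"
    using inverse_letter_absent[of l w]
    by (auto simp: lookup_add lookup_single split: if_splits)
  then show thesis using that by (meson split_list)
qed

text \<open>Induction on the length. The first letter is cancelled by an inverse letter further on,
  and l u l^-1 v is the commutator l u l^-1 u^-1 times the shorter word u v.\<close>

lemma pr_MD:
  assumes "w \<in> fwords n" "wab w = 0" shows "pr n w \<in> MD n"
  using assms
proof (induction "length w" arbitrary: w rule: less_induct)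
  case less
  interpret group "MG n" by (rule MG_group)
  have sub: "subgroup (MD n) (MG n)" by (rule derived_is_subgroup) simp
  show ?case
  proof (cases w)
    case Nil
    then show ?thesis using subgroup.one_closed[OF sub] by (simp add: pr_Nil)
  next
    case (Cons l w')
    obtain u v where w': "w' = u @ map_prod id Not l # v"
      by (rule inverse_letter_ex[OF less.prems(2)[unfolded Cons]])
    have uv: "u \<in> fwords n" "v \<in> fwords n" "fst l < n" using less.prems(1) Cons w' by auto
    have l: "[map_prod id Not l] = winv [l]" by simp
    have "wab (u @ v) = 0"
      using less.prems(2) unfolding Cons w' by (cases "snd l") (auto simp: algebra_simps single_uminus simp flip: single_add)
    then have 1: "pr n (u @ v) \<in> MD n"
      using less.hyps[of "u @ v"] uv by (simp add: Cons w')
    let ?x = "pr n [l]" and ?u = "pr n u" and ?v = "pr n v"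
    have x: "?x \<in> carrier (MG n)" "?u \<in> carrier (MG n)" "?v \<in> carrier (MG n)"
      using uv by (simp_all add: pr_carrier)
    have "pr n w = pr n ([l] @ u @ winv [l] @ v)" by (simp add: Cons w')
    also have "\<dots> = ?x \<otimes>\<^bsub>MG n\<^esub> (?u \<otimes>\<^bsub>MG n\<^esub> (inv\<^bsub>MG n\<^esub> ?x \<otimes>\<^bsub>MG n\<^esub> ?v))"
      using uv by (simp only: pr_append pr_winv fwords_simps winv_fwords simp_thms)
    also have "\<dots> = (?x \<otimes>\<^bsub>MG n\<^esub> ?u \<otimes>\<^bsub>MG n\<^esub> inv\<^bsub>MG n\<^esub> ?x \<otimes>\<^bsub>MG n\<^esub> inv\<^bsub>MG n\<^esub> ?u) \<otimes>\<^bsub>MG n\<^esub> pr n (u @ v)"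
      using x uv by (simp add: pr_append m_assoc) (simp add: inv_solve_left flip: m_assoc)
    also have "\<dots> \<in> MD n"
      using x by (intro subgroup.m_closed[OF sub _ 1]) (auto simp: derived_def intro!: generate.incl)
    finally show ?thesis .
  qed
qed

text \<open>The kernel of \<open>mab\<close> contains all commutators because the exponent vectors
  form an Abelian group; the converse is \<open>pr_MD\<close>.\<close>

lemma MD_iff: "h \<in> MD n \<longleftrightarrow> h \<in> carrier (MG n) \<and> mab n h = 0"
proof
  interpret group "MG n" by (rule MG_group)
  let ?K = "{h \<in> carrier (MG n). mab n h = 0}"
  have "derived_set (MG n) (carrier (MG n)) \<subseteq> ?K"
    by (auto simp: mab_mult mab_inv)
  moreover have "subgroup ?K (MG n)"
    by (rule subgroupI) (auto simp: mab_mult mab_inv intro!: exI[of _ "\<one>\<^bsub>MG n\<^esub>"] mab_one)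
  ultimately have "MD n \<subseteq> ?K" unfolding derived_def by (rule generate_subgroup_incl)
  then show "h \<in> MD n \<Longrightarrow> h \<in> carrier (MG n) \<and> mab n h = 0" by blast
next
  assume "h \<in> carrier (MG n) \<and> mab n h = 0"
  then show "h \<in> MD n" by (auto elim!: MG_cases simp: mab_pr pr_MD)
qed

text \<open>The left action inverse to \<open>gconj\<close>: it makes \<open>mfox\<close> on the derived subgroup linear over
  the group ring, without a sign change in the exponents.\<close>

definition conj_by :: "('a, 'b) monoid_scheme \<Rightarrow> 'a \<Rightarrow> 'a \<Rightarrow> 'a" where
  "conj_by G g z = g \<otimes>\<^bsub>G\<^esub> z \<otimes>\<^bsub>G\<^esub> inv\<^bsub>G\<^esub> g"

context group
begin

lemma conj_by_closed [simp]: "g \<in> carrier G \<Longrightarrow> z \<in> carrier G \<Longrightarrow> conj_by G g z \<in> carrier G"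
  by (simp add: conj_by_def)

lemma conj_by_mult:
  "g \<in> carrier G \<Longrightarrow> y \<in> carrier G \<Longrightarrow> z \<in> carrier G \<Longrightarrow>
    conj_by G g (y \<otimes> z) = conj_by G g y \<otimes> conj_by G g z"
  by (simp add: conj_by_def m_assoc) (simp add: inv_solve_left flip: m_assoc)

lemma conj_by_inv:
  "g \<in> carrier G \<Longrightarrow> z \<in> carrier G \<Longrightarrow> conj_by G g (inv z) = inv (conj_by G g z)"
  by (simp add: conj_by_def inv_mult_group m_assoc)

lemma conj_by_conj_by:
  "g \<in> carrier G \<Longrightarrow> h \<in> carrier G \<Longrightarrow> z \<in> carrier G \<Longrightarrow>
    conj_by G g (conj_by G h z) = conj_by G (g \<otimes> h) z"
  by (simp add: conj_by_def inv_mult_group m_assoc)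

lemma conj_by_one: "z \<in> carrier G \<Longrightarrow> conj_by G \<one> z = z"
  by (simp add: conj_by_def)

lemma conj_by_iso:
  assumes "g \<in> carrier G" shows "conj_by G g \<in> iso G G"
proof (rule isoI)
  show "conj_by G g \<in> hom G G"
    using assms by (auto intro!: homI simp: conj_by_mult)
  show "bij_betw (conj_by G g) (carrier G) (carrier G)"
    by (rule bij_betw_byWitness[of _ "conj_by G (inv g)"])
      (use assms in \<open>auto simp: conj_by_conj_by conj_by_one\<close>)
qed

lemma gconj_eq_conj_by:
  "g \<in> carrier G \<Longrightarrow> gconj G z (inv g) = conj_by G g z"
  by (simp add: gconj_def conj_by_def)

lemma gcomm_inv:
  "a \<in> carrier G \<Longrightarrow> b \<in> carrier G \<Longrightarrow> inv (gcomm G a b) = gcomm G b a"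
  by (simp add: gcomm_def inv_mult_group m_assoc)

lemma gcomm_closed: "a \<in> carrier G \<Longrightarrow> b \<in> carrier G \<Longrightarrow> gcomm G a b \<in> carrier G"
  by (simp add: gcomm_def)

lemma commute_inv:
  assumes "a \<in> carrier G" "b \<in> carrier G" "a \<otimes> b = b \<otimes> a" shows "inv a \<otimes> b = b \<otimes> inv a"
proof -
  have "inv a \<otimes> b = inv a \<otimes> (b \<otimes> a) \<otimes> inv a" using assms(1,2) by (simp add: m_assoc)
  also have "\<dots> = b \<otimes> inv a" unfolding assms(3)[symmetric] using assms(1,2) by (simp flip: m_assoc)
  finally show ?thesis .
qed

end

text \<open>As \<open>z\<close> has exponent vector 0, the contributions of \<open>g\<close> and of
  its inverse to the derivative cancel.\<close>

lemma conj_by_MD: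
  assumes "g \<in> carrier (MG n)" "z \<in> MD n"
  shows "conj_by (MG n) g z \<in> MD n"
    and "mfox n i (conj_by (MG n) g z) = frag_of (mab n g) * mfox n i z"
proof -
  interpret group "MG n" by (rule MG_group)
  have z: "z \<in> carrier (MG n)" "mab n z = 0" using assms(2) by (simp_all add: MD_iff)
  show "conj_by (MG n) g z \<in> MD n"
    using assms(1) z by (simp add: MD_iff conj_by_def mab_mult mab_inv)
  have "frag_of (mab n g) * (frag_of (- mab n g) :: za) = 1"
    by (simp flip: frag_of_add)
  then show "mfox n i (conj_by (MG n) g z) = frag_of (mab n g) * mfox n i z"
    using assms(1) z by (simp add: conj_by_def mab_mult mfox_mult mfox_inv flip: mult.assoc)
qed

text \<open>The elements \<open>g\<close> and \<open>g'\<close> differ by a factor from the Abelian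
  group \<open>MD n\<close>, which centralizes \<open>z\<close>. Hence the free Abelian group of
  exponent vectors acts on \<open>MD n\<close>.\<close>

lemma conj_by_cong:
  assumes g: "g \<in> carrier (MG n)" "g' \<in> carrier (MG n)" "mab n g = mab n g'" and z: "z \<in> MD n"
  shows "conj_by (MG n) g z = conj_by (MG n) g' z"
proof -
  interpret group "MG n" by (rule MG_group)
  have zc: "z \<in> carrier (MG n)" using z by (simp add: MD_iff)
  define k where "k = inv\<^bsub>MG n\<^esub> g' \<otimes>\<^bsub>MG n\<^esub> g"
  have k: "k \<in> MD n" "k \<in> carrier (MG n)"
    using g by (simp_all add: k_def MD_iff mab_mult mab_inv)
  have "conj_by (MG n) k z = z"
    unfolding conj_by_def MD_commute[OF k(1) z] using k(2) zc by (simp add: m_assoc)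
  then have "conj_by (MG n) g' z = conj_by (MG n) (g' \<otimes>\<^bsub>MG n\<^esub> k) z"
    using conj_by_conj_by[OF g(2) k(2) zc] by simp
  also have "g' \<otimes>\<^bsub>MG n\<^esub> k = g"
    using g by (simp add: k_def flip: m_assoc)
  finally show ?thesis ..
qed

lemma mfox_MD_diff:
  assumes "g \<in> MD n" "h \<in> MD n"
  shows "mfox n i (g \<otimes>\<^bsub>MG n\<^esub> inv\<^bsub>MG n\<^esub> h) = mfox n i g - mfox n i h"
  using assms group.inv_closed[OF MG_group, of h n] by (simp add: MD_iff mfox_mult mfox_inv)

section \<open>Rank two\<close>

abbreviation (input) c01 :: "fword set set" where
  "c01 \<equiv> gcomm (MG 2) (mgen 2 0) (mgen 2 1)"

lemma c01_MD: "c01 \<in> MD 2"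
proof -
  interpret group "MG 2" by (rule MG_group)
  show ?thesis by (simp add: MD_iff gcomm_def mgen_carrier mab_mult mab_inv)
qed

text \<open>The monomial \<open>u\<close> is the inverse of \<open>xvar 0 * xvar 1\<close>, hence a
  unit, so the two derivatives generate the augmentation ideal.\<close>

lemma mfox_c01:
  defines "u \<equiv> frag_of (- Poly_Mapping.single 0 1 - Poly_Mapping.single 1 1) :: za"
  shows "mfox 2 0 c01 = - u * (xvar 1 - 1)" "mfox 2 1 c01 = u * (xvar 0 - 1)"
proof -
  interpret group "MG 2" by (rule MG_group)
  have u: "frag_of (- Poly_Mapping.single 0 1) = u * xvar 1"
    "frag_of (- Poly_Mapping.single 1 1) = u * xvar 0"
    "xvar 0 * (xvar 1 * u) = 1"
    by (simp_all add: u_def xvar_def flip: frag_of_add)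
  have "u = frag_of (- Poly_Mapping.single 0 1 + - Poly_Mapping.single 1 1)"
    by (simp add: u_def)
  then show "mfox 2 0 c01 = - u * (xvar 1 - 1)" "mfox 2 1 c01 = u * (xvar 0 - 1)"
    using u
    by (simp_all add: gcomm_def mgen_carrier mab_mult mab_inv mab_mgen mfox_mult mfox_inv
        mfox_mgen algebra_simps)
qed

section \<open>The derived subgroup as a cyclic module\<close>

text \<open>The two generators commute modulo \<open>N\<close>. This passes to inverse letters, then
  to a letter and a word, and finally to two words by induction.\<close>

lemma quotient_commute:
  assumes N: "N \<lhd> MG 2" and c: "c01 \<in> N" and w: "u \<in> fwords 2" "v \<in> fwords 2"
  shows "(N #>\<^bsub>MG 2\<^esub> pr 2 u) \<otimes>\<^bsub>MG 2 Mod N\<^esub> (N #>\<^bsub>MG 2\<^esub> pr 2 v) =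
    (N #>\<^bsub>MG 2\<^esub> pr 2 v) \<otimes>\<^bsub>MG 2 Mod N\<^esub> (N #>\<^bsub>MG 2\<^esub> pr 2 u)"
proof -
  let ?Q = "MG 2 Mod N"
  let ?f = "\<lambda>w. N #>\<^bsub>MG 2\<^esub> pr 2 w"
  interpret M: group "MG 2" by (rule MG_group)
  interpret N: normal N "MG 2" by (rule N)
  interpret Q: group ?Q by (rule N.factorgroup_is_group)
  interpret q: group_hom "MG 2" ?Q "\<lambda>a. N #>\<^bsub>MG 2\<^esub> a"
    by (simp add: group_hom_def group_hom_axioms_def M.group_axioms Q.group_axioms N.r_coset_hom_Mod)
  have fc: "?f w \<in> carrier ?Q" if "w \<in> fwords 2" for w
    using that by (intro q.hom_closed pr_carrier)
  have app: "?f (u @ v) = ?f u \<otimes>\<^bsub>?Q\<^esub> ?f v" if "u \<in> fwords 2" "v \<in> fwords 2" for u v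
    using that by (simp only: pr_append q.hom_mult pr_carrier)
  have inv: "?f [(i, True)] = inv\<^bsub>?Q\<^esub> ?f [(i, False)]" if "i < 2" for i
  proof -
    have "[(i, True)] = winv [(i, False)]" by simp
    then show ?thesis
      using that by (simp only: pr_winv q.hom_inv pr_carrier fwords_simps fst_conv simp_thms)
  qed
  have nil: "?f [] = \<one>\<^bsub>?Q\<^esub>"
    unfolding pr_Nil by (rule q.hom_one)
  let ?com = "\<lambda>u v. ?f u \<otimes>\<^bsub>?Q\<^esub> ?f v = ?f v \<otimes>\<^bsub>?Q\<^esub> ?f u"
  have gen: "?com [(0, False)] [(1, False)]"
  proof -
    let ?a = "mgen 2 0" and ?b = "mgen 2 1"
    have ab: "?a \<in> carrier (MG 2)" "?b \<in> carrier (MG 2)" by (simp_all add: mgen_carrier)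
    have "?b \<otimes>\<^bsub>MG 2\<^esub> ?a \<otimes>\<^bsub>MG 2\<^esub> c01 = ?a \<otimes>\<^bsub>MG 2\<^esub> ?b"
      using ab unfolding gcomm_def by (simp add: M.m_assoc) (simp flip: M.m_assoc)
    then have "N #>\<^bsub>MG 2\<^esub> (?a \<otimes>\<^bsub>MG 2\<^esub> ?b) =
        (N #>\<^bsub>MG 2\<^esub> (?b \<otimes>\<^bsub>MG 2\<^esub> ?a)) \<otimes>\<^bsub>?Q\<^esub> (N #>\<^bsub>MG 2\<^esub> c01)"
      using ab M.gcomm_closed[OF ab] by (metis q.hom_mult M.m_closed)
    also have "N #>\<^bsub>MG 2\<^esub> c01 = \<one>\<^bsub>?Q\<^esub>"
      using c M.coset_join2[OF N.mem_carrier N.subgroup_axioms] by simp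
    finally have "N #>\<^bsub>MG 2\<^esub> (?a \<otimes>\<^bsub>MG 2\<^esub> ?b) = N #>\<^bsub>MG 2\<^esub> (?b \<otimes>\<^bsub>MG 2\<^esub> ?a)"
      using ab by (metis Q.r_one q.hom_closed M.m_closed)
    then show ?thesis
      using ab by (metis mgen_eq_pr q.hom_mult)
  qed
  have letters: "?com [l] [m]" if "fst l < 2" "fst m < 2" for l m
  proof -
    have pos: "?com [(i, False)] [(j, False)]" if "i < 2" "j < 2" for i j
      using that gen by (auto simp: less_2_cases_iff)
    obtain i b j d where lm: "l = (i, b)" "m = (j, d)" by (cases l; cases m)
    then have ij: "i < 2" "j < 2" using that by simp_all
    then have ic: "?f [(i, False)] \<in> carrier ?Q" "?f [(j, False)] \<in> carrier ?Q" by (simp_all add: fc)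
    note 1 = Q.commute_inv[OF ic pos[OF ij]]
    note 2 = Q.commute_inv[OF ic(2) ic(1) pos[OF ij, symmetric]]
    note 3 = Q.commute_inv[OF ic(2) Q.inv_closed[OF ic(1)] 1[symmetric]]
    show ?thesis
      using pos[OF ij] 1 2 3 ij by (cases b; cases d) (simp_all only: lm inv)
  qed
  have step: "?com [l] w" if "fst l < 2" "w \<in> fwords 2" for l w
    using that(2)
  proof (induction w)
    case Nil
    have "?f [l] \<in> carrier ?Q" using that(1) by (simp add: fc)
    then show ?case unfolding nil by (simp only: Q.l_one Q.r_one)
  next
    case (Cons m w)
    have cl: "?f [l] \<in> carrier ?Q" "?f [m] \<in> carrier ?Q" "?f w \<in> carrier ?Q"
      using that Cons.prems by (simp_all add: fc)
    have "?f (m # w) = ?f [m] \<otimes>\<^bsub>?Q\<^esub> ?f w"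
      using app[of "[m]" w] Cons.prems by simp
    then show ?case
      using cl Cons letters[of l m] that(1) by (metis Q.m_assoc fwords_simps(2))
  qed
  show ?thesis
    using w(1)
  proof (induction u)
    case Nil
    show ?case unfolding nil using fc[OF w(2)] by (simp only: Q.l_one Q.r_one)
  next
    case (Cons l u)
    have cl: "?f [l] \<in> carrier ?Q" "?f u \<in> carrier ?Q" "?f v \<in> carrier ?Q"
      using w Cons.prems by (simp_all add: fc)
    have "?f (l # u) = ?f [l] \<otimes>\<^bsub>?Q\<^esub> ?f u"
      using app[of "[l]" u] Cons.prems by simp
    then show ?case
      using cl Cons step[of l v] w(2) by (metis Q.m_assoc fwords_simps(2))
  qed
qed

text \<open>The quotient by \<open>N\<close> is Abelian. In other words, the derived subgroup is the
  normal closure of the basic commutator.\<close>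

lemma MD_subset_normal:
  assumes N: "N \<lhd> MG 2" and c: "c01 \<in> N"
  shows "MD 2 \<subseteq> N"
proof (rule group.derived_minimal[OF MG_group N])
  show "comm_group (MG 2 Mod N)"
  proof (rule group.group_comm_groupI)
    show "group (MG 2 Mod N)" by (rule normal.factorgroup_is_group[OF N])
    fix x y assume "x \<in> carrier (MG 2 Mod N)" "y \<in> carrier (MG 2 Mod N)"
    then show "x \<otimes>\<^bsub>MG 2 Mod N\<^esub> y = y \<otimes>\<^bsub>MG 2 Mod N\<^esub> x"
      using quotient_commute[OF N c] by (auto simp: carrier_FactGroup MG_carrier simp del: mult_FactGroup)
  qed
qed

text \<open>\<open>E r\<close> is the group ring element \<open>r\<close> applied to
  \<open>z\<close> in the module \<open>MD n\<close>. It comes from the universal property of the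
  free Abelian group on the monomials, whose target is the commutative group
  \<open>MD n\<close>.\<close>

lemma MD_exponential:
  assumes z: "z \<in> MD n"
  obtains E :: "za \<Rightarrow> fword set set" where
    "\<And>r. r \<in> ZA n \<Longrightarrow> E r \<in> MD n"
    "\<And>r s. r \<in> ZA n \<Longrightarrow> s \<in> ZA n \<Longrightarrow> E (r - s) = E r \<otimes>\<^bsub>MG n\<^esub> inv\<^bsub>MG n\<^esub> E s"
    "\<And>g. g \<in> carrier (MG n) \<Longrightarrow> E (frag_of (mab n g)) = conj_by (MG n) g z"
proof -
  interpret M: group "MG n" by (rule MG_group)
  let ?S = "{a. Poly_Mapping.keys a \<subseteq> {..<n}}"
  let ?D = "MG n\<lparr>carrier := MD n\<rparr>"
  \<comment> \<open>The image of a monomial: conjugation by any group element above it, the choice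
    being harmless by \<open>conj_by_cong\<close>.\<close>
  define C where "C a = conj_by (MG n) (SOME g. g \<in> carrier (MG n) \<and> mab n g = a) z" for a
  have sub: "subgroup (MD n) (MG n)" by (rule M.derived_is_subgroup) simp
  interpret D: comm_group ?D
    by (rule group.group_comm_groupI[OF M.subgroup_imp_group[OF sub]]) (simp add: MD_commute)
  have C: "C (mab n g) = conj_by (MG n) g z" if g: "g \<in> carrier (MG n)" for g
  proof -
    let ?g = "SOME g'. g' \<in> carrier (MG n) \<and> mab n g' = mab n g"
    have "?g \<in> carrier (MG n) \<and> mab n ?g = mab n g"
      by (rule someI[of _ g]) (simp add: g)
    then show ?thesis unfolding C_def using g z by (intro conj_by_cong) simp_all
  qed
  have "C ` ?S \<subseteq> carrier ?D"
  proof clarify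
    fix a :: "nat \<Rightarrow>\<^sub>0 int" assume "Poly_Mapping.keys a \<subseteq> {..<n}"
    then obtain g where "g \<in> carrier (MG n)" "mab n g = a" by (rule mab_surj)
    then show "C a \<in> carrier ?D" using C conj_by_MD(1)[OF _ z] by auto
  qed
  then obtain E where E: "E \<in> hom (free_Abelian_group ?S) ?D" "\<forall>a\<in>?S. E (frag_of a) = C a"
    by (rule D.free_Abelian_group_universal) blast
  interpret E: group_hom "free_Abelian_group ?S" ?D E
    by (simp add: group_hom_def group_hom_axioms_def E(1) D.group_axioms)
  have mem: "E r \<in> MD n" if "r \<in> ZA n" for r
    using E.hom_closed[of r] that by (simp add: ZA_iff)
  show thesis
  proof (rule that)
    show "E (frag_of (mab n g)) = conj_by (MG n) g z" if "g \<in> carrier (MG n)" for g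
      using bspec[OF E(2), of "mab n g"] C[OF that] mab_keys[OF that] by simp
    fix r s assume rs: "r \<in> ZA n" "s \<in> ZA n"
    have "E (r - s) = E r \<otimes>\<^bsub>?D\<^esub> inv\<^bsub>?D\<^esub> E s"
      using E.hom_mult[of r "- s"] E.hom_inv[of s] rs by (simp add: ZA_iff)
    then show "E (r - s) = E r \<otimes>\<^bsub>MG n\<^esub> inv\<^bsub>MG n\<^esub> E s"
      using M.m_inv_consistent[OF sub mem[OF rs(2)]] by simp
  qed (rule mem)
qed

text \<open>The multiples \<open>E r\<close> of the basic commutator form a normal subgroup
  containing it, hence exhaust \<open>MD 2\<close>. The last two conjuncts translate a coefficient
  \<open>r\<close> that is a monomial up to sign back into a conjugate, so that \<open>E\<close> can
  stay hidden.\<close>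

lemma MD_eq_multiple_c01:
  assumes "h \<in> MD 2"
  shows "\<exists>r\<in>ZA 2. (\<forall>i. mfox 2 i h = r * mfox 2 i c01) \<and>
    (\<forall>g\<in>carrier (MG 2). r = frag_of (mab 2 g) \<longrightarrow> h = conj_by (MG 2) g c01) \<and>
    (\<forall>g\<in>carrier (MG 2). r = - frag_of (mab 2 g) \<longrightarrow> h = conj_by (MG 2) g (inv\<^bsub>MG 2\<^esub> c01))"
proof -
  interpret M: group "MG 2" by (rule MG_group)
  obtain E where mem: "\<And>r. r \<in> ZA 2 \<Longrightarrow> E r \<in> MD 2"
    and E_diff: "\<And>r s. r \<in> ZA 2 \<Longrightarrow> s \<in> ZA 2 \<Longrightarrow> E (r - s) = E r \<otimes>\<^bsub>MG 2\<^esub> inv\<^bsub>MG 2\<^esub> E s"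
    and E: "\<And>g. g \<in> carrier (MG 2) \<Longrightarrow> E (frag_of (mab 2 g)) = conj_by (MG 2) g c01"
    using MD_exponential[OF c01_MD] by metis
  have memc: "E r \<in> carrier (MG 2)" if "r \<in> ZA 2" for r
    using mem[OF that] by (simp add: MD_iff)
  have E_zero: "E 0 = \<one>\<^bsub>MG 2\<^esub>"
    using E_diff[of 0 0] memc[of 0] by simp
  have cc: "c01 \<in> carrier (MG 2)" using c01_MD by (simp add: MD_iff)
  have mon: "\<exists>g\<in>carrier (MG 2). mab 2 g = a" if "Poly_Mapping.keys a \<subseteq> {..<2}" for a
    using mab_surj[OF that] by blast
  have fox: "mfox 2 i (E r) = r * mfox 2 i c01" if "r \<in> ZA 2" for r i
    using that[unfolded ZA_iff]
  proof (induction r rule: free_Abelian_group_induct[consumes 1, case_names zero diff one])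
    case zero
    show ?case by (simp add: E_zero mfox_one)
  next
    case (diff x y)
    then have "x \<in> ZA 2" "y \<in> ZA 2" by (simp_all add: ZA_iff)
    with diff show ?case by (simp add: E_diff mfox_MD_diff mem left_diff_distrib)
  next
    case (one a)
    then obtain g where "g \<in> carrier (MG 2)" "mab 2 g = a" using mon by blast
    then show ?case using E conj_by_MD(2)[OF _ c01_MD] by auto
  qed
  \<comment> \<open>Conjugation corresponds to multiplication of \<open>r\<close> by a monomial, so
    the set of all \<open>E r\<close> is normal.\<close>
  have conj: "conj_by (MG 2) g (E r) = E (frag_of (mab 2 g) * r)"
    if g: "g \<in> carrier (MG 2)" and r: "r \<in> ZA 2" for g r
    using r[unfolded ZA_iff]
  proof (induction r rule: free_Abelian_group_induct[consumes 1, case_names zero diff one])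
    case zero
    show ?case using g by (simp add: E_zero conj_by_def)
  next
    case (diff x y)
    then have xy: "x \<in> ZA 2" "y \<in> ZA 2" by (simp_all add: ZA_iff)
    have "frag_of (mab 2 g) \<in> ZA 2" using mab_keys[OF g] by simp
    with diff xy g show ?case
      by (simp add: E_diff memc right_diff_distrib ZA_mult M.conj_by_mult M.conj_by_inv)
  next
    case (one a)
    then obtain h where h: "h \<in> carrier (MG 2)" "mab 2 h = a" using mon by blast
    have "frag_of (mab 2 g) * frag_of a = (frag_of (mab 2 (g \<otimes>\<^bsub>MG 2\<^esub> h)) :: za)"
      using g h by (simp add: mab_mult frag_of_add)
    then show ?case
      using E[OF h(1)] E[OF M.m_closed[OF g h(1)]] M.conj_by_conj_by[OF g h(1) cc] h(2) by simp
  qed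
  have "E ` ZA 2 \<lhd> MG 2"
    unfolding M.normal_inv_iff
  proof (intro conjI ballI)
    show "subgroup (E ` ZA 2) (MG 2)"
    proof (rule M.subgroupI)
      fix x assume "x \<in> E ` ZA 2"
      then obtain r where r: "r \<in> ZA 2" "x = E r" by blast
      have "inv\<^bsub>MG 2\<^esub> x = E (0 - r)"
        using r memc E_diff[of 0 r] by (simp add: E_zero)
      moreover have "0 - r \<in> ZA 2" by (rule ZA_minus[OF ZA_0 r(1)])
      ultimately show "inv\<^bsub>MG 2\<^esub> x \<in> E ` ZA 2" by (metis imageI)
    next
      fix x y assume "x \<in> E ` ZA 2" "y \<in> E ` ZA 2"
      then obtain r s where rs: "r \<in> ZA 2" "x = E r" "s \<in> ZA 2" "y = E s" by blast
      have "E (- s) = inv\<^bsub>MG 2\<^esub> y" using rs memc E_diff[of 0 s] by (simp add: E_zero)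
      then have "x \<otimes>\<^bsub>MG 2\<^esub> y = E (r - (- s))"
        using rs memc E_diff[of r "- s"] by (simp add: ZA_uminus)
      moreover have "r - (- s) \<in> ZA 2" by (rule ZA_minus[OF rs(1) ZA_uminus[OF rs(3)]])
      ultimately show "x \<otimes>\<^bsub>MG 2\<^esub> y \<in> E ` ZA 2" by (metis imageI)
    next
      show "E ` ZA 2 \<subseteq> carrier (MG 2)" using memc by blast
      show "E ` ZA 2 \<noteq> {}" using imageI[OF ZA_0] by (metis empty_iff)
    qed
    fix g x assume g: "g \<in> carrier (MG 2)" and "x \<in> E ` ZA 2"
    then obtain r where r: "r \<in> ZA 2" "x = E r" by blast
    have "frag_of (mab 2 g) * r \<in> ZA 2" using mab_keys[OF g] r(1) by (simp add: ZA_mult)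
    then show "g \<otimes>\<^bsub>MG 2\<^esub> x \<otimes>\<^bsub>MG 2\<^esub> inv\<^bsub>MG 2\<^esub> g \<in> E ` ZA 2"
      using conj[OF g r(1)] r(2) unfolding conj_by_def by auto
  qed
  moreover have "c01 \<in> E ` ZA 2"
  proof -
    have "E 1 = c01" using E[OF M.one_closed] cc by (simp add: mab_one M.conj_by_one)
    then show ?thesis using ZA_1 by blast
  qed
  ultimately obtain r where r: "r \<in> ZA 2" "h = E r"
    using MD_subset_normal assms by blast
  show ?thesis
  proof (intro bexI[OF _ r(1)] conjI allI ballI impI)
    show "mfox 2 i h = r * mfox 2 i c01" for i
      using fox r by simp
    fix g assume g: "g \<in> carrier (MG 2)"
    show "h = conj_by (MG 2) g c01" if "r = frag_of (mab 2 g)"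
      using E[OF g] r(2) that by simp
    show "h = conj_by (MG 2) g (inv\<^bsub>MG 2\<^esub> c01)" if "r = - frag_of (mab 2 g)"
    proof -
      have "frag_of (mab 2 g) \<in> ZA 2" using mab_keys[OF g] by simp
      from E_diff[OF ZA_0 this] show ?thesis
        using E[OF g] r(2) that g cc by (simp add: E_zero M.conj_by_inv)
    qed
  qed
qed

section \<open>The shape of the primitive elements in rank two\<close>

lemma delta_primitive_conj:
  assumes dp: "delta_primitive 2 h"
  obtains g where "g \<in> carrier (MG 2)"
    "h = conj_by (MG 2) g c01 \<or> h = conj_by (MG 2) g (inv\<^bsub>MG 2\<^esub> c01)"
proof -
  have "h \<in> MD 2"
    using dp delta_primitive_mab[OF dp] by (simp add: MD_iff delta_primitive_iff)
  from MD_eq_multiple_c01[OF this] obtain r where r: "r \<in> ZA 2" "\<forall>i. mfox 2 i h = r * mfox 2 i c01"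
    and h: "\<forall>g\<in>carrier (MG 2). r = frag_of (mab 2 g) \<longrightarrow> h = conj_by (MG 2) g c01"
      "\<forall>g\<in>carrier (MG 2). r = - frag_of (mab 2 g) \<longrightarrow> h = conj_by (MG 2) g (inv\<^bsub>MG 2\<^esub> c01)"
    by (elim bexE conjE)
  have dvd: "\<exists>s. r * s = xvar i - 1" if "i < 2" for i
  proof -
    have "xvar i - 1 \<in> genideal_ZA 2 (\<lambda>i. mfox 2 i h)"
      using dp xvar_minus_1_DeltaA[OF that] by (simp add: delta_primitive_iff)
    then obtain s where "xvar i - 1 = (\<Sum>j<2. s j * mfox 2 j h)" by (rule genideal_ZA_E)
    also have "\<dots> = r * (\<Sum>j<2. s j * mfox 2 j c01)"
      unfolding r(2)[rule_format] by (simp only: sum_distrib_left mult.left_commute)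
    finally show ?thesis by metis
  qed
  obtain s t where "r * s = xvar 0 - 1" "r * t = xvar 1 - 1"
    using dvd[of 0] dvd[of 1] by auto
  then obtain a where a: "a \<in> Poly_Mapping.keys r" "r = frag_of a \<or> r = - frag_of a"
    by (rule unit_of_common_divisor) simp_all
  then have "Poly_Mapping.keys a \<subseteq> {..<2}" using r(1) by (auto simp: ZA_def)
  then obtain g where g: "g \<in> carrier (MG 2)" "mab 2 g = a" by (rule mab_surj)
  have "h = conj_by (MG 2) g c01 \<or> h = conj_by (MG 2) g (inv\<^bsub>MG 2\<^esub> c01)"
    using a(2) bspec[OF h(1) g(1)] bspec[OF h(2) g(1)] unfolding g(2) by (elim disjE) simp_all
  then show thesis by (rule that[OF g(1)])
qed

section \<open>Invariance under automorphisms\<close>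

text \<open>A description free of derivatives and of the basis. Forwards, a normal subgroup
  containing a conjugate of the basic commutator or of its inverse contains the commutator
  itself.\<close>

lemma delta_primitive_iff_normal_closure:
  "delta_primitive 2 h \<longleftrightarrow> h \<in> MD 2 \<and> (\<forall>N. N \<lhd> MG 2 \<longrightarrow> h \<in> N \<longrightarrow> MD 2 \<subseteq> N)"
proof
  interpret M: group "MG 2" by (rule MG_group)
  have cc: "c01 \<in> carrier (MG 2)" using c01_MD by (simp add: MD_iff)
  assume dp: "delta_primitive 2 h"
  then obtain g where g: "g \<in> carrier (MG 2)"
    and h: "h = conj_by (MG 2) g c01 \<or> h = conj_by (MG 2) g (inv\<^bsub>MG 2\<^esub> c01)"
    by (rule delta_primitive_conj)
  have "MD 2 \<subseteq> N" if N: "N \<lhd> MG 2" and hN: "h \<in> N" for N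
  proof (rule MD_subset_normal[OF N])
    have "conj_by (MG 2) (inv\<^bsub>MG 2\<^esub> g) h \<in> N"
      unfolding conj_by_def using g hN by (intro normal.inv_op_closed2[OF N]) simp_all
    moreover have "conj_by (MG 2) (inv\<^bsub>MG 2\<^esub> g) h \<in> {c01, inv\<^bsub>MG 2\<^esub> c01}"
      using h g cc by (auto simp: M.conj_by_conj_by M.conj_by_one)
    ultimately have "c01 \<in> N \<or> inv\<^bsub>MG 2\<^esub> c01 \<in> N" by auto
    then show "c01 \<in> N"
      using subgroup.m_inv_closed[OF normal_imp_subgroup[OF N]] cc by (metis M.inv_inv)
  qed
  moreover have "h \<in> MD 2"
    using dp delta_primitive_mab[OF dp] by (simp add: MD_iff delta_primitive_iff)
  ultimately show "h \<in> MD 2 \<and> (\<forall>N. N \<lhd> MG 2 \<longrightarrow> h \<in> N \<longrightarrow> MD 2 \<subseteq> N)" by blast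
next
  interpret M: group "MG 2" by (rule MG_group)
  assume h: "h \<in> MD 2 \<and> (\<forall>N. N \<lhd> MG 2 \<longrightarrow> h \<in> N \<longrightarrow> MD 2 \<subseteq> N)"
  let ?I = "genideal_ZA 2 (\<lambda>i. mfox 2 i h)"
  \<comment> \<open>The elements whose derivatives lie in the ideal of \<open>h\<close>. This is a
    normal subgroup containing \<open>h\<close>, so it contains the basic commutator, whose
    derivatives generate the augmentation ideal.\<close>
  let ?J = "{z \<in> MD 2. \<forall>i<2. mfox 2 i z \<in> ?I}"
  have sub: "subgroup (MD 2) (MG 2)" by (rule M.derived_is_subgroup) simp
  have "?J \<lhd> MG 2"
    unfolding M.normal_inv_iff
  proof (intro conjI ballI)
    show "subgroup ?J (MG 2)"
    proof (rule M.subgroupI)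
      show "?J \<subseteq> carrier (MG 2)" using MD_subset by blast
      have "\<one>\<^bsub>MG 2\<^esub> \<in> ?J" using subgroup.one_closed[OF sub] by (simp add: mfox_one)
      then show "?J \<noteq> {}" by blast
    next
      fix x assume x: "x \<in> ?J"
      then have "x \<in> MD 2" by blast
      then have "x \<in> carrier (MG 2)" "mab 2 x = 0" by (simp_all add: MD_iff)
      then show "inv\<^bsub>MG 2\<^esub> x \<in> ?J"
        using x subgroup.m_inv_closed[OF sub] by (simp add: mfox_inv genideal_ZA_uminus)
    next
      fix x y assume xy: "x \<in> ?J" "y \<in> ?J"
      then have "x \<in> MD 2" "y \<in> MD 2" by blast+
      then have "x \<in> carrier (MG 2)" "mab 2 x = 0" "y \<in> carrier (MG 2)" by (simp_all add: MD_iff)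
      then show "x \<otimes>\<^bsub>MG 2\<^esub> y \<in> ?J"
        using xy subgroup.m_closed[OF sub] by (simp add: mfox_mult genideal_ZA_add)
    qed
    fix g x assume g: "g \<in> carrier (MG 2)" and x: "x \<in> ?J"
    then have xD: "x \<in> MD 2" by blast
    have "frag_of (mab 2 g) \<in> ZA 2" using mab_keys[OF g] by simp
    then have "conj_by (MG 2) g x \<in> ?J"
      using x conj_by_MD[OF g xD] by (simp add: genideal_ZA_mult)
    then show "g \<otimes>\<^bsub>MG 2\<^esub> x \<otimes>\<^bsub>MG 2\<^esub> inv\<^bsub>MG 2\<^esub> g \<in> ?J" by (simp add: conj_by_def)
  qed
  moreover have "h \<in> ?J"
    using h genideal_ZA_generator[of _ 2 "\<lambda>i. mfox 2 i h"] by blast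
  ultimately have "c01 \<in> ?J" using h c01_MD by blast
  then have I: "mfox 2 0 c01 \<in> ?I" "mfox 2 1 c01 \<in> ?I" by simp_all
  \<comment> \<open>The monomial of \<open>a\<close> is inverse to the unit in
    \<open>mfox_c01\<close>; multiplying by it clears that unit.\<close>
  define a :: "nat \<Rightarrow>\<^sub>0 int" where "a = Poly_Mapping.single 0 1 + Poly_Mapping.single 1 1"
  have a: "frag_of a \<in> ZA 2"
    using ZA_mult[OF xvar_ZA[of 0 2] xvar_ZA[of 1 2]] by (simp add: a_def xvar_def frag_of_add)
  have a1: "frag_of a * (frag_of (- Poly_Mapping.single 0 1 - Poly_Mapping.single 1 1) :: za) = 1"
    by (simp add: a_def flip: frag_of_add)
  have "- frag_of a * mfox 2 0 c01 = xvar 1 - 1" "frag_of a * mfox 2 1 c01 = xvar 0 - 1"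
    unfolding mfox_c01 using a1 by (simp_all flip: mult.assoc)
  then have "xvar 1 - 1 \<in> ?I" "xvar 0 - 1 \<in> ?I"
    using genideal_ZA_mult[OF I(1) ZA_uminus[OF a]] genideal_ZA_mult[OF I(2) a] by simp_all
  then have "genideal_ZA 2 (\<lambda>i. xvar i - 1) \<subseteq> ?I"
    by (intro genideal_ZA_subset) (auto simp: less_2_cases_iff)
  then have "DeltaA 2 \<subseteq> ?I" using DeltaA_subset_genideal by blast
  moreover have "?I \<subseteq> DeltaA 2"
    using h by (intro genideal_ZA_subset_DeltaA mfox_DeltaA) (simp_all add: MD_iff)
  ultimately show "delta_primitive 2 h"
    using h by (simp add: delta_primitive_iff MD_iff)
qed

lemma delta_primitive_iso:
  assumes \<phi>: "\<phi> \<in> iso (MG 2) (MG 2)" and dp: "delta_primitive 2 h"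
  shows "delta_primitive 2 (\<phi> h)"
proof -
  interpret M: group "MG 2" by (rule MG_group)
  interpret \<phi>: group_hom "MG 2" "MG 2" \<phi>
    using \<phi> by (simp add: group_hom_def group_hom_axioms_def M.group_axioms iso_def)
  have "\<phi> ` carrier (MG 2) = carrier (MG 2)"
    using \<phi> by (simp add: iso_def bij_betw_def)
  then have MD: "\<phi> ` MD 2 = MD 2" using \<phi>.derived_img[of "carrier (MG 2)"] by simp
  have h: "h \<in> MD 2" "\<And>N. N \<lhd> MG 2 \<Longrightarrow> h \<in> N \<Longrightarrow> MD 2 \<subseteq> N"
    using dp by (simp_all add: delta_primitive_iff_normal_closure)
  have "MD 2 \<subseteq> N" if N: "N \<lhd> MG 2" and hN: "\<phi> h \<in> N" for N
  proof -
    \<comment> \<open>The preimage of \<open>N\<close> is normal and contains \<open>h\<close>, so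
      it contains \<open>MD 2\<close>; applying \<phi>, which maps \<open>MD 2\<close> onto itself,
      finishes the argument.\<close>
    let ?N = "{x \<in> carrier (MG 2). \<phi> x \<in> N}"
    interpret N: normal N "MG 2" by (rule N)
    have "?N \<lhd> MG 2"
      unfolding M.normal_inv_iff
    proof (intro conjI ballI)
      show "subgroup ?N (MG 2)"
        by (rule M.subgroupI) (auto intro!: exI[of _ "\<one>\<^bsub>MG 2\<^esub>"])
    qed (auto simp: N.inv_op_closed2)
    then have "MD 2 \<subseteq> ?N"
      using h hN MD_subset by (metis (no_types, lifting) mem_Collect_eq subsetD)
    then have "\<phi> ` MD 2 \<subseteq> N" by blast
    then show ?thesis unfolding MD .
  qed
  then show ?thesis
    using h(1) MD by (auto simp: delta_primitive_iff_normal_closure)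
qed

section \<open>The exchange of the two generators, and transitivity\<close>

text \<open>It induces an automorphism that inverts the basic commutator. Other indices are fixed
  because a class \<open>fclass w\<close> also contains words with further generators, and the map
  has to be an involution on these too.\<close>

definition swap01 :: "fword \<Rightarrow> fword" where
  "swap01 = map (map_prod (\<lambda>i. if i = 0 then 1 else if i = 1 then 0 else i) id)"

lemma swap01_swap01 [simp]: "swap01 (swap01 w) = w"
  by (induction w) (auto simp: swap01_def)

lemma swap01_append: "swap01 (u @ v) = swap01 u @ swap01 v"
  by (simp add: swap01_def)

lemma swap01_fwords: "w \<in> fwords 2 \<Longrightarrow> swap01 w \<in> fwords 2"
  by (induction w) (auto simp: swap01_def)

lemma fequiv_swap01: "fequiv u v \<Longrightarrow> fequiv (swap01 u) (swap01 v)"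
proof (induction rule: fequiv_induct)
  case (fred u v)
  then show ?case
  proof cases
    case (1 x i b y)
    then show ?thesis
      unfolding swap01_def by (auto intro!: fequiv_fred fred.intros)
  qed
qed (auto intro: fequiv_sym fequiv_trans)

lemma fclass_swap01: "swap01 ` fclass w = fclass (swap01 w)"
proof
  show "swap01 ` fclass w \<subseteq> fclass (swap01 w)"
    by (auto simp: fclass_def fequiv_swap01)
  show "fclass (swap01 w) \<subseteq> swap01 ` fclass w"
  proof
    fix v assume "v \<in> fclass (swap01 w)"
    then have "fequiv (swap01 w) v" by (simp add: fclass_def)
    from fequiv_swap01[OF this] have "swap01 v \<in> fclass w" by (simp add: fclass_def)
    then show "v \<in> swap01 ` fclass w" by (metis imageI swap01_swap01)
  qed
qed

text \<open>A surjective endomorphism maps each derived subgroup onto itself; applied twice.\<close>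

lemma FG2_swap01: "(`) swap01 ` FG2 2 = FG2 2"
proof -
  interpret F: group "FG 2" by (rule FG_group)
  interpret group_hom "FG 2" "FG 2" "(`) swap01"
  proof (unfold_locales, rule homI)
    fix A B assume "A \<in> carrier (FG 2)" "B \<in> carrier (FG 2)"
    then obtain u v where "u \<in> fwords 2" "A = fclass u" "v \<in> fwords 2" "B = fclass v"
      by (auto simp: FG_carrier)
    then show "swap01 ` (A \<otimes>\<^bsub>FG 2\<^esub> B) = swap01 ` A \<otimes>\<^bsub>FG 2\<^esub> swap01 ` B"
      by (simp add: fclass_swap01 swap01_append)
  qed (auto simp: FG_carrier fclass_swap01 swap01_fwords)
  have "A \<in> (`) swap01 ` carrier (FG 2)" if A: "A \<in> carrier (FG 2)" for A
  proof -
    obtain w where w: "w \<in> fwords 2" "A = fclass w" using A by (auto simp: FG_carrier)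
    then have "A = swap01 ` fclass (swap01 w)" by (simp add: fclass_swap01)
    then show ?thesis using w swap01_fwords by (auto simp: FG_carrier)
  qed
  moreover have "(`) swap01 ` carrier (FG 2) \<subseteq> carrier (FG 2)"
    by (auto simp: FG_carrier fclass_swap01 swap01_fwords)
  ultimately have surj: "(`) swap01 ` carrier (FG 2) = carrier (FG 2)" by blast
  then have "(`) swap01 ` derived (FG 2) (carrier (FG 2)) = derived (FG 2) (carrier (FG 2))"
    using derived_img[of "carrier (FG 2)"] by simp
  then show ?thesis
    unfolding FG2_def using derived_img[of "derived (FG 2) (carrier (FG 2))"]
    by (simp add: F.derived_in_carrier)
qed

lemma pr_swap01:
  assumes "w \<in> fwords 2" shows "(`) swap01 ` pr 2 w = pr 2 (swap01 w)"
proof -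
  have FG2: "FG2 2 \<subseteq> fclass ` fwords 2" using FG2_subset by blast
  have mult: "swap01 ` (A \<otimes>\<^bsub>FG 2\<^esub> fclass w) = swap01 ` A \<otimes>\<^bsub>FG 2\<^esub> fclass (swap01 w)"
    if A: "A \<in> FG2 2" for A
  proof -
    obtain v where "A = fclass v" using A FG2 by blast
    then show ?thesis by (simp add: fclass_swap01 swap01_append)
  qed
  have "(`) swap01 ` pr 2 w = (\<lambda>A. swap01 ` (A \<otimes>\<^bsub>FG 2\<^esub> fclass w)) ` FG2 2"
    unfolding pr_def r_coset_def by blast
  also have "\<dots> = (\<lambda>A. swap01 ` A \<otimes>\<^bsub>FG 2\<^esub> fclass (swap01 w)) ` FG2 2"
    by (rule image_cong[OF refl mult])
  also have "\<dots> = (\<lambda>A. A \<otimes>\<^bsub>FG 2\<^esub> fclass (swap01 w)) ` ((`) swap01 ` FG2 2)"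
    by (simp only: image_image)
  also have "\<dots> = pr 2 (swap01 w)"
    unfolding FG2_swap01 pr_def r_coset_def by blast
  finally show ?thesis .
qed

text \<open>Group elements are sets of sets of words, so the map on words acts on them through two
  nested images. It is its own inverse.\<close>

lemma swap01_iso: "(`) ((`) swap01) \<in> iso (MG 2) (MG 2)"
proof (rule isoI)
  show "(`) ((`) swap01) \<in> hom (MG 2) (MG 2)"
  proof (rule homI)
    fix g h assume "g \<in> carrier (MG 2)" "h \<in> carrier (MG 2)"
    then obtain u v where uv: "u \<in> fwords 2" "g = pr 2 u" "v \<in> fwords 2" "h = pr 2 v"
      by (auto simp: MG_carrier)
    then have "(`) swap01 ` pr 2 (u @ v) = pr 2 (swap01 u @ swap01 v)"
      by (simp add: pr_swap01 swap01_append)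
    then show "(`) swap01 ` (g \<otimes>\<^bsub>MG 2\<^esub> h) = (`) swap01 ` g \<otimes>\<^bsub>MG 2\<^esub> (`) swap01 ` h"
      using uv by (simp add: pr_append pr_swap01 swap01_fwords)
  qed (auto simp: MG_carrier pr_swap01 swap01_fwords)
  show "bij_betw ((`) ((`) swap01)) (carrier (MG 2)) (carrier (MG 2))"
    by (rule bij_betw_byWitness[of _ "(`) ((`) swap01)"])
      (auto simp: image_image MG_carrier pr_swap01 swap01_fwords)
qed

lemma swap01_c01: "(`) swap01 ` c01 = inv\<^bsub>MG 2\<^esub> c01"
proof -
  interpret M: group "MG 2" by (rule MG_group)
  interpret \<phi>: group_hom "MG 2" "MG 2" "(`) ((`) swap01)"
    using swap01_iso by (simp add: group_hom_def group_hom_axioms_def M.group_axioms iso_def)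
  have "(`) swap01 ` mgen 2 0 = mgen 2 1" "(`) swap01 ` mgen 2 1 = mgen 2 0"
    by (simp_all add: mgen_eq_pr pr_swap01) (simp_all add: swap01_def)
  then have "(`) swap01 ` c01 = gcomm (MG 2) (mgen 2 1) (mgen 2 0)"
    by (simp add: gcomm_def mgen_carrier)
  then show ?thesis by (simp add: M.gcomm_inv mgen_carrier)
qed

text \<open>An inner automorphism reaches the conjugates of the basic commutator; composed with the
  exchange of generators it reaches the conjugates of the inverse.\<close>

lemma delta_primitive_orbit:
  assumes "delta_primitive 2 h" shows "\<exists>\<phi>\<in>iso (MG 2) (MG 2). \<phi> c01 = h"
proof -
  interpret M: group "MG 2" by (rule MG_group)
  obtain g where g: "g \<in> carrier (MG 2)"
    and h: "h = conj_by (MG 2) g c01 \<or> h = conj_by (MG 2) g (inv\<^bsub>MG 2\<^esub> c01)"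
    using assms by (rule delta_primitive_conj)
  have "conj_by (MG 2) g \<circ> (`) ((`) swap01) \<in> iso (MG 2) (MG 2)"
    using swap01_iso M.conj_by_iso[OF g] by (rule iso_set_trans)
  moreover have "(conj_by (MG 2) g \<circ> (`) ((`) swap01)) c01 = conj_by (MG 2) g (inv\<^bsub>MG 2\<^esub> c01)"
    by (simp only: comp_apply swap01_c01)
  ultimately show ?thesis
    using h M.conj_by_iso[OF g] by metis
qed

theorem theorem1p4:
  shows "(\<forall>\<phi>\<in>iso (MG 2) (MG 2). \<forall>h. delta_primitive 2 h \<longrightarrow> delta_primitive 2 (\<phi> h))
       \<and> (\<forall>h h'. delta_primitive 2 h \<and> delta_primitive 2 h' \<longrightarrow>
              (\<exists>\<phi>\<in>iso (MG 2) (MG 2). \<phi> h = h'))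
       \<and> (\<forall>h. delta_primitive 2 h \<longrightarrow>
              (\<exists>\<phi>\<in>iso (MG 2) (MG 2). \<phi> (gcomm (MG 2) (mgen 2 0) (mgen 2 1)) = h)
            \<and> (\<exists>g\<in>carrier (MG 2).
                  h = gconj (MG 2) (gcomm (MG 2) (mgen 2 0) (mgen 2 1)) g
                \<or> h = gconj (MG 2) (gcomm (MG 2) (mgen 2 1) (mgen 2 0)) g))
       \<and> (\<forall>n::nat. 2 \<le> n \<and> odd n \<longrightarrow> \<not> (\<exists>h. delta_primitive n h))"
proof (intro conjI allI ballI impI)
  interpret M: group "MG 2" by (rule MG_group)
  have gens: "mgen 2 0 \<in> carrier (MG 2)" "mgen 2 1 \<in> carrier (MG 2)" by (simp_all add: mgen_carrier)
  show "delta_primitive 2 (\<phi> h)" if "\<phi> \<in> iso (MG 2) (MG 2)" "delta_primitive 2 h" for \<phi> h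
    using that by (rule delta_primitive_iso)
  show "\<exists>\<phi>\<in>iso (MG 2) (MG 2). \<phi> h = h'" if "delta_primitive 2 h \<and> delta_primitive 2 h'" for h h'
  proof -
    obtain \<phi> \<psi> where \<phi>: "\<phi> \<in> iso (MG 2) (MG 2)" "\<phi> c01 = h" and \<psi>: "\<psi> \<in> iso (MG 2) (MG 2)" "\<psi> c01 = h'"
      using \<open>delta_primitive 2 h \<and> delta_primitive 2 h'\<close> delta_primitive_orbit by metis
    \<comment> \<open>Both elements lie in the orbit of the basic commutator: go back along \<phi>,
      then forth along \<psi>.\<close>
    let ?\<phi>' = "inv_into (carrier (MG 2)) \<phi>"
    have "inj_on \<phi> (carrier (MG 2))" using \<phi>(1) by (simp add: iso_def bij_betw_def)
    then have "?\<phi>' h = c01"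
      unfolding \<phi>(2)[symmetric] by (rule inv_into_f_f) (rule M.gcomm_closed[OF gens])
    moreover have "\<psi> \<circ> ?\<phi>' \<in> iso (MG 2) (MG 2)"
      using M.iso_set_sym[OF \<phi>(1)] \<psi>(1) by (rule iso_set_trans)
    ultimately show ?thesis using \<psi>(2) by (intro bexI[of _ "\<psi> \<circ> ?\<phi>'"]) simp_all
  qed
  fix h assume dp: "delta_primitive 2 h"
  show "\<exists>\<phi>\<in>iso (MG 2) (MG 2). \<phi> c01 = h"
    using dp by (rule delta_primitive_orbit)
  obtain g where g: "g \<in> carrier (MG 2)"
    and h: "h = conj_by (MG 2) g c01 \<or> h = conj_by (MG 2) g (inv\<^bsub>MG 2\<^esub> c01)"
    using dp by (rule delta_primitive_conj)
  show "\<exists>g\<in>carrier (MG 2). h = gconj (MG 2) c01 g \<or> h = gconj (MG 2) (gcomm (MG 2) (mgen 2 1) (mgen 2 0)) g"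
    \<comment> \<open>\<open>gconj\<close> puts the inverse on the left and \<open>conj_by\<close>
      on the right, whence the inverse of \<open>g\<close> as witness.\<close>
    using g h by (intro bexI[of _ "inv\<^bsub>MG 2\<^esub> g"]) (simp_all add: M.gconj_eq_conj_by M.gcomm_inv gens del: One_nat_def)
next
  show "\<not> (\<exists>h. delta_primitive n h)" if "2 \<le> n \<and> odd n" for n
    using that no_delta_primitive_odd by blast
qed

end
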